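(* Let $D$ be an oriented path with $\mathcal{C}(P_3,D)=0$ and $\mathcal{C}(P_5,D)\notin\{0,-\mathcal{C}(2P_3,D)\}$. (i) If $\mathcal{C}(P_5,D)>0$ and $\mathcal{C}(P_5,D)>-\mathcal{C}(2P_3,D)$, then $D$ is locally tournament Sidorenko (LTS). (ii) If $\mathcal{C}(P_5,D)<0$ and $\mathcal{C}(P_5,D)<-\mathcal{C}(2P_3,D)$, then $D$ is locally tournament anti-Sidorenko (LTAS). (iii) Otherwise, i.e. if either $\mathcal{C}(P_5,D)>0$ and $\mathcal{C}(P_5,D)<-\mathcal{C}(2P_3,D)$, or $\mathcal{C}(P_5,D)<0$ and $\mathcal{C}(P_5,D)>-\mathcal{C}(2P_3,D)$, then $D$ is neither LTS nor LTAS.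
   Context: A weighted tournament on $n$ vertices is a function $A:[n]^2\to[0,1]$ with $A(x,y)+A(y,x)=1$ for all $x,y$ (so $A(x,x)=1/2$). For a digraph $D$, $t_D(A)=n^{-v(D)}\sum_{\phi:V(D)\to[n]}\prod_{(x,y)\in E(D)}A(\phi(x),\phi(y))$. Write $A=\frac12J+B$ with $J$ the all-ones matrix and $B$ skew-symmetric, and let $\lambda_{\max}(B)$ be the largest modulus of an eigenvalue of $B$. $D$ is LTS if there is $\varepsilon=\varepsilon(D)>0$ such that for every $n$ and every weighted tournament $A=\frac12J+B$ on $n$ vertices with $\lambda_{\max}(B)\le\varepsilon n$ one has $t_D(A)\ge2^{-e(D)}$; it is LTAS if there is such an $\varepsilon$ with $t_D(A)\le2^{-e(D)}$ for all such $A$. An oriented path is an orientation of a finite path. $P_m$ is the directed path on $m$ vertices with all edges oriented left to right; $2P_3$ is the vertex-disjoint union of two copies of $P_3$. For $G=P_{2k+1}$ ($k\ge1$) or $G=2P_3$, the signed count $\mathcal{C}(G,D)$ is the sum of $(-1)^{r(D')}$ over all (not necessarily induced) subgraphs $D'$ of $D$ without isolated vertices whose underlying undirected graph is isomorphic to that of $G$, where $r(D')$ is the number of edges of $G$ whose direction is reversed under an isomorphism from the underlying graph of $G$ to that of $D'$ (its parity is independent of the isomorphism because each component has an even number of edges). *)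

theory Defs
  imports
    "Jordan_Normal_Form.Spectral_Radius"
    "Graph_Theory.Digraph_Component"
begin

section \<open>Weighted tournaments and the local Sidorenko properties\<close>

text \<open>The vertex set \<open>[n]\<close> is \<open>{0..<n}\<close>.\<close>

definition weighted_tournament :: "nat \<Rightarrow> real mat \<Rightarrow> bool" where
  "weighted_tournament n A \<longleftrightarrow>
     A \<in> carrier_mat n n \<and>
     (\<forall>x<n. \<forall>y<n. 0 \<le> A $$ (x, y) \<and> A $$ (x, y) \<le> 1 \<and> A $$ (x, y) + A $$ (y, x) = 1)"

definition hom_density :: "'v pair_pre_digraph \<Rightarrow> real mat \<Rightarrow> real" where
  "hom_density D A =
     (\<Sum>\<phi> \<in> pverts D \<rightarrow>\<^sub>E {0..<dim_row A}. \<Prod>(x, y) \<in> parcs D. A $$ (\<phi> x, \<phi> y))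
       / real (dim_row A) ^ card (pverts D)"

text \<open>The matrix \<open>B\<close> with \<open>A = 1/2 J + B\<close>.\<close>

definition skew_part :: "real mat \<Rightarrow> real mat" where
  "skew_part A = A - mat (dim_row A) (dim_col A) (\<lambda>_. 1/2)"

text \<open>The eigenvalues of the real matrix \<open>B\<close> are its complex ones.\<close>

definition lambda_max :: "real mat \<Rightarrow> real" where
  "lambda_max B = spectral_radius (map_mat complex_of_real B)"

text \<open>The condition \<open>n \<ge> 1\<close> matters: \<^const>\<open>spectral_radius\<close> is unspecified on the empty matrix.\<close>

definition LTS :: "'v pair_pre_digraph \<Rightarrow> bool" where
  "LTS D \<longleftrightarrow> (\<exists>\<epsilon>>0. \<forall>n\<ge>1. \<forall>A.
     weighted_tournament n A \<and> lambda_max (skew_part A) \<le> \<epsilon> * real n \<longrightarrow>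
     hom_density D A \<ge> (1/2) ^ card (parcs D))"

definition LTAS :: "'v pair_pre_digraph \<Rightarrow> bool" where
  "LTAS D \<longleftrightarrow> (\<exists>\<epsilon>>0. \<forall>n\<ge>1. \<forall>A.
     weighted_tournament n A \<and> lambda_max (skew_part A) \<le> \<epsilon> * real n \<longrightarrow>
     hom_density D A \<le> (1/2) ^ card (parcs D))"

section \<open>Oriented paths and signed counts\<close>

definition dpath :: "nat \<Rightarrow> nat pair_pre_digraph" where
  "dpath m = \<lparr> pverts = {0..<m}, parcs = {(i, Suc i) | i. Suc i < m} \<rparr>"

definition disjoint_union ::
    "'a pair_pre_digraph \<Rightarrow> 'b pair_pre_digraph \<Rightarrow> ('a + 'b) pair_pre_digraph" where
  "disjoint_union G H =
     \<lparr> pverts = pverts G <+> pverts H,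
       parcs = map_prod Inl Inl ` parcs G \<union> map_prod Inr Inr ` parcs H \<rparr>"

abbreviation two_P3 :: "(nat + nat) pair_pre_digraph" where
  "two_P3 \<equiv> disjoint_union (dpath 3) (dpath 3)"

text \<open>
  An undirected graph is represented by its symmetric digraph, so the underlying graph of \<open>D\<close> is
  \<open>mk_symmetric (with_proj D)\<close>.
\<close>

definition underlying_iso :: "('a \<Rightarrow> 'b) \<Rightarrow> 'a pair_pre_digraph \<Rightarrow> 'b pair_pre_digraph \<Rightarrow> bool" where
  "underlying_iso f G H \<longleftrightarrow>
     bij_betw f (pverts G) (pverts H) \<and>
     parcs (mk_symmetric (with_proj H)) = map_prod f f ` parcs (mk_symmetric (with_proj G))"

definition oriented_path :: "'v pair_pre_digraph \<Rightarrow> bool" where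
  "oriented_path D \<longleftrightarrow>
     pair_digraph D \<and> asym (parcs D) \<and> (\<exists>m\<ge>1. \<exists>f. underlying_iso f (dpath m) D)"

definition num_reversed :: "('a \<Rightarrow> 'b) \<Rightarrow> 'a pair_pre_digraph \<Rightarrow> 'b pair_pre_digraph \<Rightarrow> nat" where
  "num_reversed f G H = card {(x, y) \<in> parcs G. (f y, f x) \<in> parcs H}"

definition copies :: "'a pair_pre_digraph \<Rightarrow> 'v pair_pre_digraph \<Rightarrow> 'v pair_pre_digraph set" where
  "copies G D =
     {D'. subgraph (with_proj D') (with_proj D) \<and>
          (\<forall>v \<in> pverts D'. \<exists>w. (v, w) \<in> parcs D' \<or> (w, v) \<in> parcs D') \<and>
          (\<exists>f. underlying_iso f G D')}"

text \<open>
  Only meaningful when every component of \<open>G\<close> is a directed path with an even number of edges and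
  \<open>D\<close> has no antiparallel arcs; the sign then does not depend on the choice of isomorphism.
\<close>

definition signed_count :: "'a pair_pre_digraph \<Rightarrow> 'v pair_pre_digraph \<Rightarrow> int" where
  "signed_count G D =
     (\<Sum>D' \<in> copies G D. (-1) ^ num_reversed (SOME f. underlying_iso f G D') G D')"

end

theory Submission
  imports Defs "HOL-Analysis.Convex"
begin

text \<open>
  Let \<open>T = B / n\<close>, \<open>w k = \<langle>T\<^sup>k 1, 1\<rangle>\<close> and \<open>a k = \<parallel>T\<^sup>k 1\<parallel>\<^sup>2\<close>.
  Expanding \<open>\<Prod>(1/2 + B)\<close> over the arcs of the path \<open>D\<close> gives a sum over arc sets \<open>R\<close>, whose
  densities factor over the runs of consecutive arcs of \<open>R\<close>; a run of \<open>k\<close> arcs contributes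
  \<open>\<plusminus> w k\<close>. By skew-symmetry \<open>w k = 0\<close> for odd \<open>k\<close> and \<open>w (2 k) = (-1)\<^sup>k a k\<close>. Hence the arc sets of
  size at most 4 contribute \<open>1 - 4 C(P3) a 1 + 16 (C(P5) a 2 + C(2P3) (a 1)\<^sup>2)\<close> to \<open>2\<^sup>e t\<close>. If
  \<open>\<lambda> \<le> \<epsilon> n\<close> then \<open>a (k + 1) \<le> (2 \<epsilon>)\<^sup>2 a k\<close>, so that the larger arc sets are dominated by \<open>a 2\<close>; as
  \<open>(a 1)\<^sup>2 \<le> a 2\<close>, this yields (i) and (ii). For (iii), take \<open>B\<close> supported on two vertices out of
  \<open>n\<close>: then \<open>(a 1)\<^sup>2 = (2 / n) a 2\<close>, and \<open>n = 2\<close> and large \<open>n\<close> give the two opposite signs.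
\<close>

section \<open>Walk densities of skew-symmetric kernels\<close>

text \<open>By log-convexity the ratios \<open>a (Suc k) / a k\<close> are nondecreasing, so a
  single ratio \<open>q > r\<close> persists and makes \<open>a\<close> grow at least like
  \<open>q ^ j\<close>, against \<open>growth\<close>.\<close>

lemma logconvex_step:
  fixes a :: "nat \<Rightarrow> real"
  assumes nonneg: "\<And>k. a k \<ge> 0"
    and logconvex: "\<And>k. (a (Suc k))\<^sup>2 \<le> a k * a (Suc (Suc k))"
    and growth: "\<And>k. a k \<le> C * r ^ k"
    and r: "r > 0"
  shows "a (Suc k) \<le> r * a k"
proof (rule ccontr)
  assume "\<not> a (Suc k) \<le> r * a k"
  then have gt: "a (Suc k) > r * a k" by simp
  have pos: "a k > 0"
  proof (rule ccontr)
    assume "\<not> a k > 0"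
    then have "a k = 0" using nonneg[of k] by simp
    then show False using logconvex[of k] gt by simp
  qed
  define q where "q = a (Suc k) / a k"
  have q: "q > r" using gt pos by (simp add: q_def field_simps)
  have step: "a (k + j) > 0 \<and> a (k + Suc j) \<ge> q * a (k + j)" for j
  proof (induction j)
    case 0
    then show ?case using pos by (simp add: q_def)
  next
    case (Suc j)
    have p1: "a (k + Suc j) > 0"
      using Suc q r by (meson less_le_trans mult_pos_pos order_less_trans)
    have "q * a (k + j) * a (k + Suc j) \<le> a (k + Suc j) * a (k + Suc j)"
      using Suc p1 by (intro mult_right_mono) auto
    also have "\<dots> \<le> a (k + j) * a (k + Suc (Suc j))"
      using logconvex[of "k + j"] by (simp add: power2_eq_square)
    finally have "a (k + j) * (q * a (k + Suc j)) \<le> a (k + j) * a (k + Suc (Suc j))"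
      by (simp add: mult_ac)
    then show ?case using Suc p1 by simp
  qed
  have geo: "a (k + j) \<ge> q ^ j * a k" for j
  proof (induction j)
    case (Suc j)
    have "q ^ Suc j * a k \<le> q * a (k + j)"
      using Suc q r by (simp add: mult.assoc mult_left_mono)
    then show ?case using step[of j] by linarith
  qed simp
  have "(q / r) ^ j \<le> C * r ^ k / a k" for j
  proof -
    have "q ^ j * a k \<le> C * r ^ k * r ^ j"
      using geo[of j] growth[of "k + j"] by (simp add: power_add mult_ac)
    then show ?thesis using pos r by (simp add: power_divide field_simps)
  qed
  moreover obtain j where "(q / r) ^ j > C * r ^ k / a k"
    using real_arch_pow[of "q / r"] q r by auto
  ultimately show False by (meson not_le)
qed

locale skew_kernel =
  fixes n :: nat and B :: "nat \<Rightarrow> nat \<Rightarrow> real"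
  assumes n_pos: "n > 0"
    and skew: "x < n \<Longrightarrow> y < n \<Longrightarrow> B y x = - B x y"
begin

definition ip :: "(nat \<Rightarrow> real) \<Rightarrow> (nat \<Rightarrow> real) \<Rightarrow> real" where
  "ip u v = (\<Sum>x<n. u x * v x) / n"

text \<open>Row vectors are multiplied on the right by \<open>B / n\<close>, so that
  \<open>walk k x\<close> is the normalised weight of the walks with \<open>k\<close> arcs ending at
  \<open>x\<close> and a path grows at its right end.\<close>

definition push :: "(nat \<Rightarrow> real) \<Rightarrow> nat \<Rightarrow> real" where
  "push u = (\<lambda>x. (\<Sum>y<n. u y * B y x) / n)"

definition walk :: "nat \<Rightarrow> nat \<Rightarrow> real" where
  "walk k = (push ^^ k) (\<lambda>_. 1)"

definition moment :: "nat \<Rightarrow> real" where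
  "moment k = ip (walk k) (\<lambda>_. 1)"

definition energy :: "nat \<Rightarrow> real" where
  "energy k = ip (walk k) (walk k)"

lemma walk_0: "walk 0 = (\<lambda>_. 1)"
  by (simp add: walk_def)

lemma walk_Suc: "walk (Suc k) = push (walk k)"
  by (simp add: walk_def)

lemma ip_commute: "ip u v = ip v u"
  by (simp add: ip_def mult.commute)

lemma ip_self_nonneg: "ip u u \<ge> 0"
  by (simp add: ip_def sum_nonneg)

lemma ip_push: "ip (push u) v = - ip u (push v)"
proof -
  have "ip (push u) v = (\<Sum>x<n. \<Sum>y<n. u y * B y x * v x) / n / n"
    by (simp add: ip_def push_def sum_distrib_right sum_divide_distrib)
  also have "(\<Sum>x<n. \<Sum>y<n. u y * B y x * v x) = (\<Sum>y<n. \<Sum>x<n. u y * B y x * v x)"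
    by (rule sum.swap)
  also have "\<dots> = (\<Sum>y<n. \<Sum>x<n. - (u y * (v x * B x y)))"
  proof (intro sum.cong refl)
    fix x y assume "x \<in> {..<n}" "y \<in> {..<n}"
    then show "u y * B y x * v x = - (u y * (v x * B x y))"
      using skew[of x y] by simp
  qed
  also have "\<dots> / n / n = - ip u (push v)"
    by (simp add: ip_def push_def sum_distrib_left sum_divide_distrib sum_negf)
  finally show ?thesis .
qed

lemma ip_walk_shift: "ip (walk (i + k)) (walk j) = (-1) ^ k * ip (walk i) (walk (j + k))"
proof (induction k arbitrary: j)
  case (Suc k)
  have "ip (walk (i + Suc k)) (walk j) = - ip (walk (i + k)) (walk (Suc j))"
    by (simp add: walk_Suc ip_push)
  then show ?case using Suc[of "Suc j"] by simp
qed simp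

lemma moment_eq: "moment (i + j) = (-1) ^ j * ip (walk i) (walk j)"
  using ip_walk_shift[of i j 0] by (simp add: moment_def walk_0)

lemma moment_even: "moment (2 * k) = (-1) ^ k * energy k"
  using moment_eq[of k k] by (simp add: energy_def mult_2)

text \<open>Skew-adjointness of \<open>push\<close> moves the extra factor in
  \<open>ip (walk (Suc j)) (walk j)\<close> across at the cost of a sign, and symmetry of
  \<open>ip\<close> moves it back for free.\<close>

lemma moment_odd: "odd k \<Longrightarrow> moment k = 0"
proof (elim oddE)
  fix j assume k: "k = 2 * j + 1"
  have "ip (walk (Suc j)) (walk j) = - ip (walk (Suc j)) (walk j)"
    by (subst walk_Suc, subst ip_push, subst walk_Suc[symmetric], subst ip_commute) rule
  then show ?thesis using moment_eq[of "Suc j" j] k by (simp add: mult_2)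
qed

lemma energy_0: "energy 0 = 1"
  using n_pos by (simp add: energy_def walk_0 ip_def)

lemma energy_nonneg: "energy k \<ge> 0"
  by (simp add: energy_def ip_self_nonneg)

lemma ip_Cauchy_Schwarz: "(ip u v)\<^sup>2 \<le> ip u u * ip v v"
  using Cauchy_Schwarz_ineq_sum[of u v "{..<n}"] n_pos
  by (simp add: ip_def power_divide divide_simps power2_eq_square)

text \<open>Moving one \<open>push\<close> across turns \<open>energy (Suc k)\<close> into
  \<open>- ip (walk k) (walk (Suc (Suc k)))\<close>, to which Cauchy-Schwarz applies.\<close>

lemma energy_logconvex: "(energy (Suc k))\<^sup>2 \<le> energy k * energy (Suc (Suc k))"
proof -
  have "energy (Suc k) = - ip (walk k) (walk (Suc (Suc k)))"
    unfolding energy_def by (subst walk_Suc, subst ip_push) (simp add: walk_Suc)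
  then show ?thesis
    using ip_Cauchy_Schwarz[of "walk k" "walk (Suc (Suc k))"] by (simp add: energy_def)
qed

text \<open>A crude pointwise bound suffices: \<open>C\<close> may depend on \<open>n\<close> and
  \<open>B\<close>, since log-convexity retains only the exponential rate.\<close>

lemma energy_growth_imp_step:
  assumes "\<And>k x. x < n \<Longrightarrow> \<bar>walk k x\<bar> \<le> C * r ^ k" and r: "r > 0"
  shows "energy (Suc k) \<le> r\<^sup>2 * energy k"
proof (rule logconvex_step[where a = energy and C = "C\<^sup>2"])
  show "energy k \<le> C\<^sup>2 * (r\<^sup>2) ^ k" for k
  proof -
    have "walk k x * walk k x \<le> C\<^sup>2 * (r\<^sup>2) ^ k" if "x < n" for x
    proof -
      have "\<bar>walk k x\<bar>\<^sup>2 \<le> (C * r ^ k)\<^sup>2"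
        using assms(1)[OF that] by (intro power_mono) auto
      then show ?thesis
        by (simp add: power2_eq_square power_mult_distrib mult_ac)
    qed
    then have "(\<Sum>x<n. walk k x * walk k x) \<le> real n * (C\<^sup>2 * (r\<^sup>2) ^ k)"
      using sum_bounded_above[of "{..<n}" "\<lambda>x. walk k x * walk k x"] by simp
    then show ?thesis using n_pos by (simp add: energy_def ip_def divide_simps mult_ac)
  qed
qed (use r in \<open>auto simp: energy_nonneg energy_logconvex\<close>)

end

section \<open>Spectral radius and growth of walks\<close>

text \<open>An eigenvector of the rescaled matrix is one of \<open>B\<close>, with the eigenvalue
  multiplied by \<open>c\<close>. A spectral radius below 1 is the form in which powers are known to
  stay bounded.\<close>

lemma spectral_radius_scaled_less_1:
  fixes B :: "complex mat"
  assumes B: "B \<in> carrier_mat n n" and n: "n > 0" and c: "c > 0" and sr: "spectral_radius B < c"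
  shows "spectral_radius (complex_of_real (1 / c) \<cdot>\<^sub>m B) < 1"
proof -
  let ?C = "complex_of_real (1 / c) \<cdot>\<^sub>m B"
  have C: "?C \<in> carrier_mat n n" using B by simp
  from spectral_radius_mem_max(1)[OF C n] obtain k where
    k: "k \<in> spectrum ?C" and sk: "spectral_radius ?C = norm k" by auto
  from k obtain v where v: "eigenvector ?C v k"
    by (auto simp: spectrum_def eigenvalue_def)
  then have v': "v \<in> carrier_vec n" "v \<noteq> 0\<^sub>v n" "?C *\<^sub>v v = k \<cdot>\<^sub>v v"
    using B by (auto simp: eigenvector_def)
  have "B *\<^sub>v v = (complex_of_real c * k) \<cdot>\<^sub>v v"
  proof -
    have "B *\<^sub>v v = complex_of_real c \<cdot>\<^sub>v (?C *\<^sub>v v)"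
      using B v'(1) c by (intro eq_vecI) (auto simp: scalar_prod_def sum_distrib_left)
    then show ?thesis using v'(3) by (simp add: smult_smult_assoc)
  qed
  then have "eigenvector B v (complex_of_real c * k)"
    using v' B by (auto simp: eigenvector_def)
  then have "norm (complex_of_real c * k) \<in> norm ` spectrum B"
    unfolding spectrum_def eigenvalue_def by blast
  from spectral_radius_mem_max(2)[OF B n this] sr have "norm (complex_of_real c * k) < c"
    by simp
  then show ?thesis using c sk by (simp add: norm_mult)
qed

text \<open>Transfers bounds on matrix powers to walks. Column sums appear because
  \<open>push\<close> multiplies row vectors, and \<open>r ^ k\<close> undoes the scaling by
  \<open>1 / r\<close>.\<close>

lemma walk_eq_col_sum_pow:
  fixes B :: "real mat"
  assumes B: "B \<in> carrier_mat n n" and "skew_kernel n (\<lambda>x y. B $$ (x, y))" and r: "r > 0" and x: "x < n"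
  shows "complex_of_real (skew_kernel.walk n (\<lambda>x y. B $$ (x, y)) k x) =
    of_real r ^ k * (\<Sum>y<n. ((of_real (1 / (r * n)) \<cdot>\<^sub>m map_mat complex_of_real B) ^\<^sub>m k) $$ (y, x))"
  using x
proof (induction k arbitrary: x)
  interpret skew_kernel n "\<lambda>x y. B $$ (x, y)" by fact
  case 0
  then show ?case using B by (simp add: walk_0 one_mat_def)
next
  interpret skew_kernel n "\<lambda>x y. B $$ (x, y)" by fact
  case (Suc k)
  define C where "C = of_real (1 / (r * n)) \<cdot>\<^sub>m map_mat complex_of_real B"
  have C: "C \<in> carrier_mat n n" using B by (simp add: C_def)
  then have Ck: "C ^\<^sub>m k \<in> carrier_mat n n" by simp
  have ent: "(C ^\<^sub>m Suc k) $$ (y, x) = (\<Sum>z<n. (C ^\<^sub>m k) $$ (y, z) * C $$ (z, x))" if "y < n" for y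
    using that Suc.prems C Ck
    by (simp add: scalar_prod_def lessThan_atLeast0)
  have "(\<Sum>y<n. (C ^\<^sub>m Suc k) $$ (y, x)) = (\<Sum>y<n. \<Sum>z<n. (C ^\<^sub>m k) $$ (y, z) * C $$ (z, x))"
    using ent by simp
  also have "\<dots> = (\<Sum>z<n. (\<Sum>y<n. (C ^\<^sub>m k) $$ (y, z)) * C $$ (z, x))"
    by (subst sum.swap) (simp add: sum_distrib_right)
  also have "of_real r ^ Suc k * \<dots> = (\<Sum>z<n. of_real (walk k z) * (of_real r * C $$ (z, x)))"
    unfolding sum_distrib_left
    by (intro sum.cong) (simp_all add: Suc.IH C_def mult_ac)
  also have "\<dots> = (\<Sum>z<n. complex_of_real (walk k z) * of_real (B $$ (z, x)) / of_nat n)"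
    using Suc.prems B r by (intro sum.cong) (simp_all add: C_def)
  also have "\<dots> = of_real (walk (Suc k) x)"
    by (simp add: walk_Suc push_def sum_divide_distrib)
  finally show ?case by (simp add: C_def)
qed

text \<open>
  This replaces the spectral theorem: the energies are log-convex, so a single ratio
  \<open>energy (k + 1) / energy k\<close> above \<open>r\<^sup>2\<close> would force growth faster than \<open>r^(2 k)\<close>, against the
  boundedness of the powers of \<open>B / (r n)\<close>.
\<close>

lemma energy_step_of_lambda_max:
  fixes B :: "real mat"
  assumes B: "B \<in> carrier_mat n n" and sk: "skew_kernel n (\<lambda>x y. B $$ (x, y))"
    and r: "r > 0" and lam: "lambda_max B < r * n"
  shows "skew_kernel.energy n (\<lambda>x y. B $$ (x, y)) (Suc k)
    \<le> r\<^sup>2 * skew_kernel.energy n (\<lambda>x y. B $$ (x, y)) k"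
proof -
  interpret skew_kernel n "\<lambda>x y. B $$ (x, y)" by fact
  define C where "C = of_real (1 / (r * n)) \<cdot>\<^sub>m map_mat complex_of_real B"
  have C: "C \<in> carrier_mat n n" using B by (simp add: C_def)
  have "spectral_radius C < 1"
    unfolding C_def
    by (rule spectral_radius_scaled_less_1) (use B r n_pos lam in \<open>auto simp: lambda_max_def\<close>)
  \<comment> \<open>The Jordan normal form yields an entrywise bound on all powers that is uniform
    in the exponent.\<close>
  from spectral_radius_jnf_norm_bound_less_1_upper_triangular[OF C this]
  obtain c where c: "\<And>k. norm_bound (C ^\<^sub>m k) c" by auto
  have "\<bar>walk k x\<bar> \<le> n * c * r ^ k" if "x < n" for k x
  proof -
    have "\<bar>walk k x\<bar> = norm (complex_of_real (walk k x))" by simp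
    also have "\<dots> = r ^ k * norm (\<Sum>y<n. (C ^\<^sub>m k) $$ (y, x))"
      unfolding walk_eq_col_sum_pow[OF B sk r that] C_def using r
      by (simp add: norm_mult norm_power)
    also have "norm (\<Sum>y<n. (C ^\<^sub>m k) $$ (y, x)) \<le> (\<Sum>y<n. c)"
      using c[of k] that C by (intro sum_norm_le) (auto simp: norm_bound_def)
    finally show ?thesis using r by (simp add: mult_ac)
  qed
  from energy_growth_imp_step[OF this r] show ?thesis by simp
qed

section \<open>Densities of subgraphs of a path\<close>

text \<open>The vertex set is an argument of its own, so that all arc sets of one digraph are
  averaged over the same maps.\<close>

definition dens :: "nat \<Rightarrow> (nat \<Rightarrow> nat \<Rightarrow> real) \<Rightarrow> 'v set \<Rightarrow> 'v rel \<Rightarrow> real" where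
  "dens n B V R =
    (\<Sum>\<phi> \<in> V \<rightarrow>\<^sub>E {0..<n}. \<Prod>(x, y) \<in> R. B (\<phi> x) (\<phi> y)) / real n ^ card V"

lemma sum_PiE_insert:
  assumes "a \<notin> V"
  shows "(\<Sum>\<phi> \<in> insert a V \<rightarrow>\<^sub>E X. F \<phi>) = (\<Sum>\<phi> \<in> V \<rightarrow>\<^sub>E X. \<Sum>y\<in>X. F (\<phi>(a := y)))"
proof -
  have "(\<Sum>\<phi> \<in> insert a V \<rightarrow>\<^sub>E X. F \<phi>) = (\<Sum>(y, \<phi>) \<in> X \<times> (V \<rightarrow>\<^sub>E X). F (\<phi>(a := y)))"
    unfolding PiE_insert_eq
    by (subst sum.reindex[OF inj_combinator[OF assms]]) (simp add: case_prod_unfold)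
  then show ?thesis
    by (simp add: sum.cartesian_product[symmetric] sum.swap[of _ X])
qed

text \<open>Each vertex outside \<open>V'\<close> is free in the sum, and its factor
  \<open>n\<close> cancels against the normalisation.\<close>

lemma dens_extend:
  assumes "finite V" "V' \<subseteq> V" "R \<subseteq> V' \<times> V'" "n > 0"
  shows "dens n B V R = dens n B V' R"
proof -
  have "dens n B (V' \<union> U) R = dens n B V' R" if "finite U" "U \<inter> V' = {}" for U
    using that
  proof (induction U)
    case (insert a U)
    have a: "a \<notin> V' \<union> U" using insert by auto
    have fin: "finite (V' \<union> U)" using assms insert finite_subset by auto
    have "(\<Prod>(x, y) \<in> R. B ((\<phi>(a := z)) x) ((\<phi>(a := z)) y)) = (\<Prod>(x, y) \<in> R. B (\<phi> x) (\<phi> y))" for \<phi> z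
      by (intro prod.cong) (use assms(3) a in auto)
    then have "dens n B (insert a (V' \<union> U)) R = dens n B (V' \<union> U) R"
      using a fin assms(4) by (simp add: dens_def sum_PiE_insert sum_distrib_left[symmetric] del: insert_iff Un_iff)
    then show ?case using insert by simp
  qed simp
  from this[of "V - V'"] assms show ?thesis by (simp add: Diff_eq Un_absorb1 finite_Diff Un_Int_distrib)
qed

text \<open>
  The element \<open>i\<close> of \<open>S\<close> stands for the arc from \<open>i\<close> to \<open>i + 1\<close>; \<open>run S m\<close> is the length of the
  run of \<open>S\<close> that ends at the vertex \<open>m\<close>, and \<open>closed_runs w S m\<close> multiplies the weights of the
  runs before it.
\<close>

fun run :: "nat set \<Rightarrow> nat \<Rightarrow> nat" where
  "run S 0 = 0"
| "run S (Suc m) = (if m \<in> S then Suc (run S m) else 0)"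

fun closed_runs :: "(nat \<Rightarrow> real) \<Rightarrow> nat set \<Rightarrow> nat \<Rightarrow> real" where
  "closed_runs w S 0 = 1"
| "closed_runs w S (Suc m) = (if m \<in> S then closed_runs w S m else closed_runs w S m * w (run S m))"

lemma run_le: "run S m \<le> m"
  by (induction m) auto

lemma run_subset: "{m - run S m..<m} \<subseteq> S"
proof (induction m)
  case (Suc m)
  then show ?case using run_le[of S m] by (auto simp: less_Suc_eq Suc_diff_le)
qed simp

text \<open>\<open>k\<close> counts the arcs in the runs already closed. Closing a run multiplies in
  at most \<open>b (run S m)\<close>, which submultiplicativity merges into \<open>b\<close> of the
  total.\<close>

lemma closed_runs_bound:
  assumes b: "\<And>j. b j \<ge> (0::real)" and w: "\<And>j. \<bar>w j\<bar> \<le> b j" and one: "b 0 \<ge> 1"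
    and mult: "\<And>j k. b j * b k \<le> b (j + k)"
  shows "\<exists>k. k + run S m = card (S \<inter> {..<m}) \<and> \<bar>closed_runs w S m\<bar> \<le> b k"
proof (induction m)
  case 0
  then show ?case using one by auto
next
  case (Suc m)
  then obtain k where k: "k + run S m = card (S \<inter> {..<m})" "\<bar>closed_runs w S m\<bar> \<le> b k" by auto
  show ?case
  proof (cases "m \<in> S")
    case True
    then have "S \<inter> {..<Suc m} = insert m (S \<inter> {..<m})" by (auto simp: less_Suc_eq)
    then show ?thesis using True k by auto
  next
    case False
    then have "S \<inter> {..<Suc m} = S \<inter> {..<m}" by (auto simp: less_Suc_eq)
    moreover have "\<bar>closed_runs w S m\<bar> * \<bar>w (run S m)\<bar> \<le> b k * b (run S m)"
      using k w b by (intro mult_mono) auto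
    ultimately show ?thesis using False k mult[of k "run S m"] by (auto simp: abs_mult)
  qed
qed

lemma runs_bound:
  assumes b: "\<And>j. b j \<ge> (0::real)" and w: "\<And>j. \<bar>w j\<bar> \<le> b j" and one: "b 0 \<ge> 1"
    and mult: "\<And>j k. b j * b k \<le> b (j + k)" and S: "S \<subseteq> {..<m}"
  shows "\<bar>closed_runs w S m * w (run S m)\<bar> \<le> b (card S)"
proof -
  obtain k where k: "k + run S m = card (S \<inter> {..<m})" "\<bar>closed_runs w S m\<bar> \<le> b k"
    using closed_runs_bound[OF b w one mult] by blast
  have "\<bar>closed_runs w S m * w (run S m)\<bar> \<le> b k * b (run S m)"
    unfolding abs_mult using k w b by (intro mult_mono) auto
  also have "\<dots> \<le> b (card S)" using mult[of k "run S m"] k S by (simp add: Int_absorb2)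
  finally show ?thesis .
qed

section \<open>Even runs as disjoint dominoes\<close>

text \<open>\<open>T\<close> collects the left ends of the dominoes \<open>{t, Suc t}\<close> that
  tile the interval from its left end. Small arc sets of this form are easy to enumerate.\<close>

lemma even_interval_dominoes:
  assumes "even (r::nat)" "r \<le> m"
  shows "\<exists>T. {m - r..<m} = T \<union> Suc ` T \<and> T \<inter> Suc ` T = {} \<and> T \<subseteq> {m - r..<m}"
proof -
  obtain q where q: "r = 2 * q" using assms by auto
  define T where "T = (\<lambda>j. m - r + 2 * j) ` {..<q}"
  have "x \<in> T \<union> Suc ` T" if "x \<in> {m - r..<m}" for x
  proof -
    have "x = m - r + 2 * ((x - (m - r)) div 2) \<or> x = Suc (m - r + 2 * ((x - (m - r)) div 2))"
      using that by auto
    moreover have "(x - (m - r)) div 2 < q" using that q assms by auto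
    ultimately show ?thesis unfolding T_def by blast
  qed
  moreover have "T \<union> Suc ` T \<subseteq> {m - r..<m}" using q assms by (auto simp: T_def)
  moreover have "T \<inter> Suc ` T = {}" by (auto simp: T_def) presburger
  ultimately show ?thesis by blast
qed

text \<open>A nonzero product has no odd closed run, so every closed run can be tiled separately.
  The run still open at \<open>m\<close> has unknown parity and is cut off by
  \<open>m - run S m\<close>.\<close>

lemma closed_runs_dominoes:
  assumes odd: "\<And>j. odd j \<Longrightarrow> w j = 0" and "closed_runs w S m \<noteq> 0"
  shows "\<exists>T. S \<inter> {..<m - run S m} = T \<union> Suc ` T \<and> T \<inter> Suc ` T = {}"
  using assms(2)
proof (induction m)
  case (Suc m)
  show ?case
  proof (cases "m \<in> S")
    case False
    with Suc have nz: "closed_runs w S m \<noteq> 0" "w (run S m) \<noteq> 0" by auto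
    from Suc.IH[OF nz(1)] obtain T where T: "S \<inter> {..<m - run S m} = T \<union> Suc ` T" "T \<inter> Suc ` T = {}" by auto
    from nz odd have "even (run S m)" by auto
    from even_interval_dominoes[OF this run_le] obtain U where
      U: "{m - run S m..<m} = U \<union> Suc ` U" "U \<inter> Suc ` U = {}" by auto
    have "S \<inter> {..<Suc m} = (S \<inter> {..<m - run S m}) \<union> {m - run S m..<m}"
      using False run_subset[of m S] run_le[of S m] by (auto simp: less_Suc_eq)
    also have "\<dots> = (T \<union> U) \<union> Suc ` (T \<union> U)" using T U by auto
    finally have "S \<inter> {..<Suc m - run S (Suc m)} = (T \<union> U) \<union> Suc ` (T \<union> U)" using False by simp
    \<comment> \<open>The older dominoes lie wholly below \<open>m - run S m\<close> and the new
      ones wholly at or above it, so the two tilings cannot collide.\<close>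
    moreover have "(T \<union> Suc ` T) \<inter> (U \<union> Suc ` U) = {}" unfolding T(1)[symmetric] U(1)[symmetric] by auto
    then have "(T \<union> U) \<inter> (Suc ` T \<union> Suc ` U) = {}"
      using T(2) U(2) by (simp add: Int_Un_distrib Int_Un_distrib2 Int_commute)
    then have "(T \<union> U) \<inter> Suc ` (T \<union> U) = {}" by (simp only: image_Un)
    ultimately show ?thesis by blast
  qed (use Suc in auto)
qed auto

lemma runs_dominoes:
  assumes odd: "\<And>j. odd j \<Longrightarrow> w j = 0" and S: "S \<subseteq> {..<m}"
    and nz: "closed_runs w S m * w (run S m) \<noteq> 0"
  shows "\<exists>T. S = T \<union> Suc ` T \<and> T \<inter> Suc ` T = {}"
proof -
  \<comment> \<open>As \<open>m\<close> is not in \<open>S\<close>, passing to \<open>Suc m\<close>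
    closes the last run and leaves no open one.\<close>
  have "m \<notin> S" using S by auto
  then have "closed_runs w S (Suc m) \<noteq> 0" "run S (Suc m) = 0" using nz by auto
  with closed_runs_dominoes[of w S "Suc m", OF odd] S show ?thesis
    by (simp add: Int_absorb2 lessThan_Suc subset_insertI2)
qed

section \<open>Path densities as products of moments\<close>

context skew_kernel
begin

text \<open>The test function \<open>h\<close> at the last vertex makes the induction work: summing
  out the newest vertex only replaces \<open>h\<close> by another function of the vertex before
  it.\<close>

lemma sum_path_PiE:
  "(\<Sum>\<phi> \<in> {0..<Suc m} \<rightarrow>\<^sub>E {0..<n}. (\<Prod>i \<in> S \<inter> {..<m}. B (\<phi> i) (\<phi> (Suc i))) * h (\<phi> m))
    = real n ^ Suc m * closed_runs moment S m * ip (walk (run S m)) h"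
proof (induction m arbitrary: h)
  case 0
  have "(\<Sum>\<phi> \<in> insert 0 {} \<rightarrow>\<^sub>E {0..<n}. h (\<phi> 0)) = (\<Sum>x<n. h x)"
    by (subst sum_PiE_insert) (auto simp: lessThan_atLeast0)
  then show ?case using n_pos by (simp add: ip_def walk_0)
next
  case (Suc m)
  define h' where "h' x = (\<Sum>y<n. (if m \<in> S then B x y else 1) * h y)" for x
  have split: "{0..<Suc (Suc m)} = insert (Suc m) {0..<Suc m}" by auto
  have "(\<Sum>\<phi> \<in> {0..<Suc (Suc m)} \<rightarrow>\<^sub>E {0..<n}. (\<Prod>i \<in> S \<inter> {..<Suc m}. B (\<phi> i) (\<phi> (Suc i))) * h (\<phi> (Suc m)))
    = (\<Sum>\<phi> \<in> {0..<Suc m} \<rightarrow>\<^sub>E {0..<n}. \<Sum>y=0..<n.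
        (\<Prod>i \<in> S \<inter> {..<Suc m}. B ((\<phi>(Suc m := y)) i) ((\<phi>(Suc m := y)) (Suc i))) * h ((\<phi>(Suc m := y)) (Suc m)))"
    unfolding split by (subst sum_PiE_insert) simp_all
  also have "\<dots> = (\<Sum>\<phi> \<in> {0..<Suc m} \<rightarrow>\<^sub>E {0..<n}. \<Sum>y<n. (\<Prod>i \<in> S \<inter> {..<m}. B (\<phi> i) (\<phi> (Suc i))) *
        ((if m \<in> S then B (\<phi> m) y else 1) * h y))"
  proof (intro sum.cong)
    fix \<phi> :: "nat \<Rightarrow> nat" and y
    have "(\<Prod>i \<in> S \<inter> {..<m}. B ((\<phi>(Suc m := y)) i) ((\<phi>(Suc m := y)) (Suc i)))
      = (\<Prod>i \<in> S \<inter> {..<m}. B (\<phi> i) (\<phi> (Suc i)))"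
      by (intro prod.cong) auto
    moreover have "S \<inter> {..<Suc m} = (if m \<in> S then insert m (S \<inter> {..<m}) else S \<inter> {..<m})"
      by (auto simp: less_Suc_eq)
    ultimately show "(\<Prod>i \<in> S \<inter> {..<Suc m}. B ((\<phi>(Suc m := y)) i) ((\<phi>(Suc m := y)) (Suc i))) * h ((\<phi>(Suc m := y)) (Suc m))
      = (\<Prod>i \<in> S \<inter> {..<m}. B (\<phi> i) (\<phi> (Suc i))) * ((if m \<in> S then B (\<phi> m) y else 1) * h y)"
      by auto
  qed auto
  also have "\<dots> = (\<Sum>\<phi> \<in> {0..<Suc m} \<rightarrow>\<^sub>E {0..<n}. (\<Prod>i \<in> S \<inter> {..<m}. B (\<phi> i) (\<phi> (Suc i))) * h' (\<phi> m))"
    by (simp only: h'_def sum_distrib_left)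
  also have "\<dots> = real n ^ Suc m * closed_runs moment S m * ip (walk (run S m)) h'"
    by (rule Suc.IH)
  also have "\<dots> = real n ^ Suc (Suc m) * closed_runs moment S (Suc m) * ip (walk (run S (Suc m))) h"
  proof (cases "m \<in> S")
    case True
    \<comment> \<open>An arc in \<open>S\<close> extends the open run: summing out its head is the
      adjoint of \<open>push\<close>, up to the factor \<open>n\<close>.\<close>
    have "ip u h' = n * ip (push u) h" for u
    proof -
      have "ip u h' = (\<Sum>x<n. \<Sum>y<n. u x * B x y * h y) / n"
        using True by (simp add: ip_def h'_def sum_distrib_left mult_ac)
      also have "\<dots> = (\<Sum>y<n. (\<Sum>x<n. u x * B x y) * h y) / n"
        by (subst sum.swap) (simp add: sum_distrib_right)
      also have "\<dots> = n * ip (push u) h"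
        using n_pos by (simp add: ip_def push_def sum_divide_distrib[symmetric])
      finally show ?thesis .
    qed
    then show ?thesis using True by (simp add: walk_Suc)
  next
    case False
    \<comment> \<open>Without the arc \<open>h'\<close> is constant, so the open run closes with
      weight \<open>moment (run S m)\<close> and a new one starts from
      \<open>walk 0\<close>.\<close>
    then have "ip u h' = n * (ip u (\<lambda>_. 1) * ip (walk 0) h)" for u
      using n_pos by (simp add: ip_def h'_def walk_0 sum_distrib_right[symmetric])
    then show ?thesis using False by (simp add: moment_def)
  qed
  finally show ?case .
qed

lemma dens_path:
  assumes "S \<subseteq> {..<m}"
  shows "dens n B {0..<Suc m} ((\<lambda>i. (i, Suc i)) ` S) = closed_runs moment S m * moment (run S m)"
proof -
  have "(\<Prod>(x, y) \<in> (\<lambda>i. (i, Suc i)) ` S. B (\<phi> x) (\<phi> y)) = (\<Prod>i\<in>S \<inter> {..<m}. B (\<phi> i) (\<phi> (Suc i)))" for \<phi>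
    using assms by (subst prod.reindex) (auto simp: inj_on_def Int_absorb2)
  then show ?thesis using sum_path_PiE[of S m "\<lambda>_. 1"] n_pos
    by (simp add: dens_def moment_def)
qed

end

section \<open>Signed counts as sums of densities\<close>

lemma parcs_mk_symmetric_conv: "parcs (mk_symmetric (with_proj G)) = parcs G \<union> (parcs G)\<inverse>"
  by (auto simp: parcs_mk_symmetric)

lemma underlying_iso_conv:
  "underlying_iso f G H \<longleftrightarrow> bij_betw f (pverts G) (pverts H) \<and>
    parcs H \<union> (parcs H)\<inverse> = map_prod f f ` (parcs G \<union> (parcs G)\<inverse>)"
  by (simp add: underlying_iso_def parcs_mk_symmetric_conv)

lemma underlying_iso_comp:
  assumes "underlying_iso g G H" "underlying_iso f H K"
  shows "underlying_iso (f \<circ> g) G K"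
proof -
  have "map_prod (f \<circ> g) (f \<circ> g) ` E = map_prod f f ` map_prod g g ` E" for E
    by (simp add: image_comp map_prod_compose)
  then show ?thesis
    using assms bij_betw_trans unfolding underlying_iso_conv by metis
qed

lemma underlying_iso_arc:
  assumes "underlying_iso f G H" "(x, y) \<in> parcs G"
  shows "(f x, f y) \<in> parcs H \<or> (f y, f x) \<in> parcs H"
proof -
  have "(f x, f y) \<in> map_prod f f ` (parcs G \<union> (parcs G)\<inverse>)" using assms(2) by force
  then have "(f x, f y) \<in> parcs H \<union> (parcs H)\<inverse>"
    using assms(1) by (simp only: underlying_iso_conv)
  then show ?thesis by simp
qed

lemma underlying_iso_arc_preimage:
  assumes "underlying_iso f G H" "(u, v) \<in> parcs H"
  obtains x y where "u = f x" "v = f y" "(x, y) \<in> parcs G \<or> (y, x) \<in> parcs G"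
proof -
  have "(u, v) \<in> parcs H \<union> (parcs H)\<inverse>" using assms(2) by simp
  then have "(u, v) \<in> map_prod f f ` (parcs G \<union> (parcs G)\<inverse>)"
    using assms(1) by (simp only: underlying_iso_conv)
  then show ?thesis using that by auto
qed

text \<open>An underlying isomorphism matches edges only. Since both arc relations are asymmetric,
  each edge carries exactly one arc, and an arc is sent to whichever orientation of its image occurs
  in \<open>H\<close>.\<close>

lemma underlying_iso_arcs_bij_betw:
  assumes iso: "underlying_iso f G H" and wf: "parcs G \<subseteq> pverts G \<times> pverts G"
    and asym: "asym (parcs G)" "asym (parcs H)"
  shows "bij_betw (\<lambda>(x, y). if (f y, f x) \<in> parcs H then (f y, f x) else (f x, f y)) (parcs G) (parcs H)"
    (is "bij_betw ?g _ _")
proof (rule bij_betw_imageI)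
  have inj: "x = y" if "f x = f y" "x \<in> pverts G" "y \<in> pverts G" for x y
    using iso that by (auto simp: underlying_iso_conv bij_betw_def inj_on_def)
  show "inj_on ?g (parcs G)"
  proof (rule inj_onI)
    fix e e' assume ee: "e \<in> parcs G" "e' \<in> parcs G" "?g e = ?g e'"
    obtain x y x' y' where e: "e = (x, y)" "e' = (x', y')" by (cases e, cases e')
    have *: "(x, y) \<in> parcs G" "(x', y') \<in> parcs G" "?g (x, y) = ?g (x', y')"
      using ee unfolding e by blast+
    then have "x \<in> pverts G" "y \<in> pverts G" "x' \<in> pverts G" "y' \<in> pverts G" using wf by auto
    with *(3) have "x = x' \<and> y = y' \<or> x = y' \<and> y = x'"
      by (auto split: if_splits dest: inj)
    then show "e = e'" using * asymD[OF asym(1)] unfolding e by blast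
  qed
  show "?g ` parcs G = parcs H"
  proof (intro equalityI subsetI)
    fix e assume "e \<in> ?g ` parcs G"
    then obtain x y where "(x, y) \<in> parcs G" "e = ?g (x, y)" by auto
    then show "e \<in> parcs H" using underlying_iso_arc[OF iso, of x y] by auto
  next
    fix e assume e: "e \<in> parcs H"
    obtain u v where uv: "e = (u, v)" by (cases e)
    from underlying_iso_arc_preimage[OF iso e[unfolded uv]] obtain x y where
      xy: "u = f x" "v = f y" "(x, y) \<in> parcs G \<or> (y, x) \<in> parcs G" .
    have nrev: "(f y, f x) \<notin> parcs H" using e uv xy asymD[OF asym(2)] by auto
    from xy(3) show "e \<in> ?g ` parcs G"
    proof
      assume "(x, y) \<in> parcs G"
      moreover have "e = ?g (x, y)" using nrev uv xy by simp
      ultimately show ?thesis by blast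
    next
      assume "(y, x) \<in> parcs G"
      moreover have "e = ?g (y, x)" using e uv xy by simp
      ultimately show ?thesis by blast
    qed
  qed
qed

text \<open>Pulling maps back along \<open>f\<close> matches the factors up to the order of the
  arguments, and skewness turns each reversed arc into a factor -1. As \<open>f\<close> is
  arbitrary, the one chosen by \<open>SOME\<close> in \<open>signed_count\<close> serves as well as
  any other.\<close>

lemma (in skew_kernel) dens_underlying_iso:
  assumes iso: "underlying_iso f G H" and wf: "parcs G \<subseteq> pverts G \<times> pverts G"
    and fin: "finite (pverts G)" and asym: "asym (parcs G)" "asym (parcs H)"
  shows "dens n B (pverts H) (parcs H) = (-1) ^ num_reversed f G H * dens n B (pverts G) (parcs G)"
proof -
  let ?V = "pverts G" and ?V' = "pverts H"
  let ?g = "\<lambda>(x, y). if (f y, f x) \<in> parcs H then (f y, f x) else (f x, f y)"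
  let ?s = "\<lambda>(x, y). if (f y, f x) \<in> parcs H then - 1 else (1::real)"
  have bij: "bij_betw f ?V ?V'" using iso by (simp add: underlying_iso_conv)
  have finE: "finite (parcs G)" using wf fin by (meson finite_SigmaI finite_subset)
  have sign: "(\<Prod>e\<in>parcs G. ?s e) = (-1) ^ num_reversed f G H"
  proof -
    have "(\<Prod>e\<in>parcs G. ?s e) = (\<Prod>e\<in>{e \<in> parcs G. case e of (x, y) \<Rightarrow> (f y, f x) \<in> parcs H}. - 1)"
      using finE by (subst prod.inter_filter) (auto intro!: prod.cong split: if_splits)
    also have "{e \<in> parcs G. case e of (x, y) \<Rightarrow> (f y, f x) \<in> parcs H} = {(x, y) \<in> parcs G. (f y, f x) \<in> parcs H}"
      by auto
    finally show ?thesis by (simp add: num_reversed_def)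
  qed
  have prod: "(\<Prod>(u, v)\<in>parcs H. B (\<phi> u) (\<phi> v))
      = (-1) ^ num_reversed f G H * (\<Prod>(x, y)\<in>parcs G. B (restrict (\<phi> \<circ> f) ?V x) (restrict (\<phi> \<circ> f) ?V y))"
    if \<phi>: "\<phi> \<in> ?V' \<rightarrow>\<^sub>E {0..<n}" for \<phi>
  proof -
    have "(\<Prod>(u, v)\<in>parcs H. B (\<phi> u) (\<phi> v)) = (\<Prod>e\<in>parcs G. case ?g e of (u, v) \<Rightarrow> B (\<phi> u) (\<phi> v))"
      by (rule prod.reindex_bij_betw[symmetric, OF underlying_iso_arcs_bij_betw[OF iso wf asym]])
    also have "\<dots> = (\<Prod>e\<in>parcs G. ?s e * (case e of (x, y) \<Rightarrow> B (restrict (\<phi> \<circ> f) ?V x) (restrict (\<phi> \<circ> f) ?V y)))"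
    proof (intro prod.cong refl)
      fix e assume "e \<in> parcs G"
      moreover obtain x y where e: "e = (x, y)" by (cases e)
      ultimately have "x \<in> ?V" "y \<in> ?V" using wf by auto
      moreover from this have "\<phi> (f x) < n" "\<phi> (f y) < n"
        using \<phi> bij by (auto simp: bij_betw_def PiE_def Pi_def)
      ultimately show "(case ?g e of (u, v) \<Rightarrow> B (\<phi> u) (\<phi> v)) =
        ?s e * (case e of (x, y) \<Rightarrow> B (restrict (\<phi> \<circ> f) ?V x) (restrict (\<phi> \<circ> f) ?V y))"
        unfolding e using skew[of "\<phi> (f x)" "\<phi> (f y)"] by simp
    qed
    finally show ?thesis by (simp only: prod.distrib sign)
  qed
  have "(\<Sum>\<phi> \<in> ?V' \<rightarrow>\<^sub>E {0..<n}. \<Prod>(u, v)\<in>parcs H. B (\<phi> u) (\<phi> v))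
      = (\<Sum>\<psi> \<in> ?V \<rightarrow>\<^sub>E {0..<n}. (-1) ^ num_reversed f G H * (\<Prod>(x, y)\<in>parcs G. B (\<psi> x) (\<psi> y)))"
  proof (rule sum.reindex_bij_witness[where i = "\<lambda>\<psi>. restrict (\<psi> \<circ> inv_into ?V f) ?V'"
        and j = "\<lambda>\<phi>. restrict (\<phi> \<circ> f) ?V"])
    fix \<phi> assume \<phi>: "\<phi> \<in> ?V' \<rightarrow>\<^sub>E {0..<n}"
    show "restrict (restrict (\<phi> \<circ> f) ?V \<circ> inv_into ?V f) ?V' = \<phi>"
      using \<phi> bij by (intro ext) (auto simp: restrict_def bij_betw_def f_inv_into_f inv_into_into PiE_def extensional_def)
    show "restrict (\<phi> \<circ> f) ?V \<in> ?V \<rightarrow>\<^sub>E {0..<n}"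
      using \<phi> bij by (auto simp: bij_betw_def PiE_def Pi_def)
    show "(-1) ^ num_reversed f G H * (\<Prod>(x, y)\<in>parcs G. B (restrict (\<phi> \<circ> f) ?V x) (restrict (\<phi> \<circ> f) ?V y))
      = (\<Prod>(u, v)\<in>parcs H. B (\<phi> u) (\<phi> v))"
      using prod[OF \<phi>] by simp
  next
    fix \<psi> assume \<psi>: "\<psi> \<in> ?V \<rightarrow>\<^sub>E {0..<n}"
    show "restrict (restrict (\<psi> \<circ> inv_into ?V f) ?V' \<circ> f) ?V = \<psi>"
      using \<psi> bij by (intro ext) (auto simp: restrict_def bij_betw_def PiE_def extensional_def)
    show "restrict (\<psi> \<circ> inv_into ?V f) ?V' \<in> ?V' \<rightarrow>\<^sub>E {0..<n}"
      using \<psi> bij by (auto simp: bij_betw_def PiE_def Pi_def inv_into_into)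
  qed
  then show ?thesis
    using bij_betw_same_card[OF bij] by (simp add: dens_def sum_distrib_left)
qed

section \<open>Copies indexed by their arc sets\<close>

text \<open>A graph without isolated vertices is determined by its arcs, so copies can be indexed by
  subsets of \<open>parcs D\<close>, the index set of the density expansion.\<close>

definition arc_graph :: "'v rel \<Rightarrow> 'v pair_pre_digraph" where
  "arc_graph R = \<lparr> pverts = fst ` R \<union> snd ` R, parcs = R \<rparr>"

lemma arc_graph_sel [simp]: "pverts (arc_graph R) = fst ` R \<union> snd ` R" "parcs (arc_graph R) = R"
  by (simp_all add: arc_graph_def)

lemma underlying_iso_arc_graph:
  assumes iso: "underlying_iso f G H" and wf: "parcs G \<subseteq> pverts G \<times> pverts G"
  shows "underlying_iso f (arc_graph (parcs G)) (arc_graph (parcs H))"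
proof -
  let ?W = "fst ` parcs G \<union> snd ` parcs G"
  have sub: "?W \<subseteq> pverts G" using wf by auto
  have "f ` ?W = fst ` parcs H \<union> snd ` parcs H"
  proof -
    have *: "fst ` E \<union> snd ` E = fst ` (E \<union> E\<inverse>)" for E :: "'c rel" by force
    have "f ` fst ` (parcs G \<union> (parcs G)\<inverse>) = fst ` map_prod f f ` (parcs G \<union> (parcs G)\<inverse>)"
      by (simp add: image_comp)
    also have "\<dots> = fst ` (parcs H \<union> (parcs H)\<inverse>)" using iso by (simp add: underlying_iso_conv)
    finally show ?thesis by (simp only: *)
  qed
  moreover have "inj_on f ?W"
    using iso sub unfolding underlying_iso_conv bij_betw_def by (blast intro: inj_on_subset)
  ultimately show ?thesis using iso by (simp add: underlying_iso_conv bij_betw_def)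
qed

definition copy_arcs :: "'a pair_pre_digraph \<Rightarrow> 'v pair_pre_digraph \<Rightarrow> 'v rel set" where
  "copy_arcs G D = {R. R \<subseteq> parcs D \<and> (\<exists>f. underlying_iso f G (arc_graph R))}"

lemma copies_eq_arc_graph_image:
  assumes "pair_wf_digraph D"
  shows "copies G D = arc_graph ` copy_arcs G D"
proof (intro equalityI subsetI)
  fix D' assume "D' \<in> copies G D"
  then have sub: "subgraph (with_proj D') (with_proj D)"
    and iso: "\<forall>v \<in> pverts D'. \<exists>w. (v, w) \<in> parcs D' \<or> (w, v) \<in> parcs D'"
    and f: "\<exists>f. underlying_iso f G D'" by (auto simp: copies_def)
  have arcs: "parcs D' \<subseteq> parcs D" and "wf_digraph (with_proj D')"
    using sub by (auto simp: subgraph_def)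
  then have "fst ` parcs D' \<union> snd ` parcs D' \<subseteq> pverts D'"
    using wf_digraph.tail_in_verts[of "with_proj D'"] wf_digraph.head_in_verts[of "with_proj D'"] by auto
  moreover have "pverts D' \<subseteq> fst ` parcs D' \<union> snd ` parcs D'" using iso by force
  ultimately have "D' = arc_graph (parcs D')"
    by (intro pair_pre_digraph.equality) auto
  then show "D' \<in> arc_graph ` copy_arcs G D" using arcs f unfolding copy_arcs_def
    by (metis (mono_tags, lifting) image_eqI mem_Collect_eq)
next
  fix D' assume "D' \<in> arc_graph ` copy_arcs G D"
  then obtain R where R: "D' = arc_graph R" "R \<subseteq> parcs D" "\<exists>f. underlying_iso f G (arc_graph R)"
    by (auto simp: copy_arcs_def)
  interpret pair_wf_digraph D by fact
  have arcs_D: "parcs D \<subseteq> pverts D \<times> pverts D"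
    using arc_fst_in_verts arc_snd_in_verts by (simp add: subset_iff mem_Times_iff)
  have "wf_digraph (with_proj (arc_graph R))" by unfold_locales auto
  moreover have "pverts (arc_graph R) \<subseteq> pverts D"
    using R(2) arcs_D by auto
  moreover have "wf_digraph (with_proj D)" by unfold_locales
  ultimately have "subgraph (with_proj (arc_graph R)) (with_proj D)"
    using R by (auto simp: subgraph_def compatible_def)
  moreover have "\<forall>v \<in> pverts (arc_graph R). \<exists>w. (v, w) \<in> parcs (arc_graph R) \<or> (w, v) \<in> parcs (arc_graph R)"
    by force
  ultimately show "D' \<in> copies G D" using R by (simp add: copies_def)
qed

lemma signed_count_eq_sum_copy_arcs:
  assumes "pair_wf_digraph D"
  shows "signed_count G D = (\<Sum>R\<in>copy_arcs G D.
    (-1) ^ num_reversed (SOME f. underlying_iso f G (arc_graph R)) G (arc_graph R))"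
proof -
  have "inj_on arc_graph (copy_arcs G D)" by (rule inj_onI) (metis arc_graph_sel(2))
  then show ?thesis
    unfolding signed_count_def copies_eq_arc_graph_image[OF assms] by (subst sum.reindex) simp_all
qed

lemma asym_subset: "asym E \<Longrightarrow> R \<subseteq> E \<Longrightarrow> asym R"
  by (meson asymD asymI subsetD)

text \<open>By \<open>dens_extend\<close> and \<open>dens_underlying_iso\<close> all copies have the
  density of \<open>G\<close> up to sign, and the signs add up to
  \<open>signed_count G D\<close>.\<close>

lemma (in skew_kernel) sum_dens_copy_arcs:
  assumes D: "pair_fin_digraph D" "asym (parcs D)"
    and G: "parcs G \<subseteq> pverts G \<times> pverts G" "finite (pverts G)" "asym (parcs G)"
  shows "(\<Sum>R\<in>copy_arcs G D. dens n B (pverts D) R) = signed_count G D * dens n B (pverts G) (parcs G)"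
proof -
  interpret pair_fin_digraph D by fact
  have arcs_D: "parcs D \<subseteq> pverts D \<times> pverts D"
    using arc_fst_in_verts arc_snd_in_verts by (simp add: subset_iff mem_Times_iff)
  have "dens n B (pverts D) R = (-1) ^ num_reversed (SOME f. underlying_iso f G (arc_graph R)) G (arc_graph R)
      * dens n B (pverts G) (parcs G)" if R: "R \<in> copy_arcs G D" for R
  proof -
    have sub: "R \<subseteq> parcs D" and ex: "\<exists>f. underlying_iso f G (arc_graph R)"
      using R by (auto simp: copy_arcs_def)
    have "dens n B (pverts D) R = dens n B (pverts (arc_graph R)) (parcs (arc_graph R))"
      unfolding arc_graph_sel
    proof (rule dens_extend)
      show "fst ` R \<union> snd ` R \<subseteq> pverts D" using sub arcs_D by auto
      show "R \<subseteq> (fst ` R \<union> snd ` R) \<times> (fst ` R \<union> snd ` R)" by force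
    qed (use n_pos pair_finite_verts in auto)
    also have "\<dots> = (-1) ^ num_reversed (SOME f. underlying_iso f G (arc_graph R)) G (arc_graph R)
      * dens n B (pverts G) (parcs G)"
      by (rule dens_underlying_iso[OF someI_ex[OF ex] G]) (use asym_subset[OF D(2) sub] in simp)
    finally show ?thesis .
  qed
  moreover have "pair_wf_digraph D" by unfold_locales
  ultimately show ?thesis
    by (simp add: signed_count_eq_sum_copy_arcs sum_distrib_right)
qed

section \<open>Explicit copies inside a directed path\<close>

abbreviation steps :: "nat set \<Rightarrow> nat rel" where
  "steps S \<equiv> (\<lambda>i. (i, Suc i)) ` S"

lemma dpath_Suc_sel [simp]: "pverts (dpath (Suc m)) = {0..<Suc m}" "parcs (dpath (Suc m)) = steps {..<m}"
  by (auto simp: dpath_def)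

lemma asym_steps: "asym (steps S)"
  by (auto intro!: asymI)

lemma dpath_Suc_wf:
  "parcs (dpath (Suc m)) \<subseteq> pverts (dpath (Suc m)) \<times> pverts (dpath (Suc m))"
  "finite (pverts (dpath (Suc m)))" "asym (parcs (dpath (Suc m)))" "card (parcs (dpath (Suc m))) = m"
  using asym_steps by (auto simp: card_image inj_on_def)

lemma closed_runs_lessThan: "k \<le> m \<Longrightarrow> run {..<m} k = k \<and> closed_runs w {..<m} k = 1"
  by (induction k) auto

lemma (in skew_kernel) dens_dpath:
  "dens n B (pverts (dpath (Suc m))) (parcs (dpath (Suc m))) = moment m"
  using closed_runs_lessThan[of m m] by (simp add: dens_path del: atLeastLessThanSuc_atLeastAtMost)

lemma two_P3_sel:
  "pverts two_P3 = {Inl 0, Inl 1, Inl 2, Inr 0, Inr 1, Inr 2}"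
  "parcs two_P3 = {(Inl 0, Inl 1), (Inl 1, Inl 2), (Inr 0, Inr 1), (Inr 1, Inr 2)}"
proof -
  have "pverts (dpath 3) = {0, 1, 2}" "parcs (dpath 3) = {(0, 1), (1, 2)}"
    by (auto simp: dpath_def)
  then show "pverts two_P3 = {Inl 0, Inl 1, Inl 2, Inr 0, Inr 1, Inr 2}"
    "parcs two_P3 = {(Inl 0, Inl 1), (Inl 1, Inl 2), (Inr 0, Inr 1), (Inr 1, Inr 2)}"
    by (simp_all add: disjoint_union_def Plus_def insert_commute)
qed

lemma underlying_iso_map_prod_image:
  assumes "inj_on f (fst ` R \<union> snd ` R)"
  shows "underlying_iso f (arc_graph R) (arc_graph (map_prod f f ` R))"
proof -
  have "map_prod f f ` R \<union> (map_prod f f ` R)\<inverse> = map_prod f f ` (R \<union> R\<inverse>)"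
    unfolding image_Un by force
  then show ?thesis
    using assms by (simp add: underlying_iso_conv bij_betw_def image_Un image_comp)
qed

lemma underlying_iso_dpath3_steps:
  "underlying_iso ((+) i) (dpath 3) (arc_graph (steps {i, Suc i}))"
proof -
  let ?R = "{(0, 1), (1, 2)} :: nat rel"
  have "dpath 3 = arc_graph ?R" by (rule pair_pre_digraph.equality) (auto simp: dpath_def)
  moreover have "map_prod ((+) i) ((+) i) ` ?R = steps {i, Suc i}" by simp
  moreover have "underlying_iso ((+) i) (arc_graph ?R) (arc_graph (map_prod ((+) i) ((+) i) ` ?R))"
    by (rule underlying_iso_map_prod_image) (rule inj_on_add)
  ultimately show ?thesis by (simp only:)
qed

lemma underlying_iso_dpath5_steps:
  "underlying_iso ((+) i) (dpath 5) (arc_graph (steps {i, Suc i, Suc (Suc i), Suc (Suc (Suc i))}))"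
proof -
  let ?R = "{(0, 1), (1, 2), (2, 3), (3, 4)} :: nat rel"
  have "dpath 5 = arc_graph ?R" by (rule pair_pre_digraph.equality) (auto simp: dpath_def)
  moreover have "map_prod ((+) i) ((+) i) ` ?R = steps {i, Suc i, Suc (Suc i), Suc (Suc (Suc i))}"
    by (simp add: numeral_eq_Suc)
  moreover have "underlying_iso ((+) i) (arc_graph ?R) (arc_graph (map_prod ((+) i) ((+) i) ` ?R))"
    by (rule underlying_iso_map_prod_image) (rule inj_on_add)
  ultimately show ?thesis by (simp only:)
qed

text \<open>The first domino occupies the vertices \<open>i\<close> to \<open>i + 2\<close>, so the
  map is injective once the second starts at \<open>i + 3\<close> or later.\<close>

lemma underlying_iso_two_P3_steps:
  assumes "i + 3 \<le> k"
  shows "underlying_iso (case_sum ((+) i) ((+) k)) two_P3 (arc_graph (steps {i, Suc i, k, Suc k}))"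
proof -
  let ?R = "{(Inl 0, Inl 1), (Inl 1, Inl 2), (Inr 0, Inr 1), (Inr 1, Inr 2)} :: (nat + nat) rel"
    and ?f = "case_sum ((+) i) ((+) k)"
  have "two_P3 = arc_graph ?R"
    by (rule pair_pre_digraph.equality) (simp_all add: two_P3_sel insert_commute)
  moreover have "map_prod ?f ?f ` ?R = steps {i, Suc i, k, Suc k}" by simp
  moreover have "inj_on ?f (fst ` ?R \<union> snd ` ?R)" using assms by (simp add: inj_on_def)
  ultimately show ?thesis using underlying_iso_map_prod_image[of ?f ?R] by simp
qed

lemma asym_two_P3: "asym (parcs two_P3)"
  by (auto intro!: asymI simp: two_P3_sel)

text \<open>The two components are realised on a path with six vertices by leaving out its middle
  arc; the two runs of length 2 then multiply.\<close>

lemma (in skew_kernel) dens_two_P3: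
  "dens n B (pverts two_P3) (parcs two_P3) = (moment 2)\<^sup>2"
proof -
  let ?S = "{0, Suc 0, 3, Suc 3}" and ?f = "case_sum ((+) 0) ((+) 3)"
  have "{(x, y) \<in> parcs two_P3. (?f y, ?f x) \<in> parcs (arc_graph (steps ?S))} = {}"
    by (auto simp: two_P3_sel)
  then have "num_reversed ?f two_P3 (arc_graph (steps ?S)) = 0"
    by (simp only: num_reversed_def card.empty)
  moreover have "dens n B (pverts (arc_graph (steps ?S))) (parcs (arc_graph (steps ?S))) =
      (-1) ^ num_reversed ?f two_P3 (arc_graph (steps ?S)) * dens n B (pverts two_P3) (parcs two_P3)"
    by (rule dens_underlying_iso[OF underlying_iso_two_P3_steps])
      (use asym_two_P3 asym_steps[of ?S] in \<open>auto simp: two_P3_sel\<close>)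
  moreover have "pverts (arc_graph (steps ?S)) = {0..<Suc 5}"
    by (auto simp: numeral_eq_Suc less_Suc_eq)
  moreover have "dens n B {0..<Suc 5} (steps ?S) = (moment 2)\<^sup>2"
    by (subst dens_path) (simp_all add: numeral_eq_Suc)
  ultimately show ?thesis by simp
qed

text \<open>\<open>S\<close> lists the positions along the path whose edge occurs in
  \<open>R\<close>, in either direction. Both vertex sets stay full so that the given
  \<open>f\<close> can be reused.\<close>

lemma underlying_iso_path_subgraph:
  assumes iso: "underlying_iso f (dpath (Suc m)) D" and R: "R \<subseteq> parcs D"
    and S: "S = {i. i < m \<and> ((f i, f (Suc i)) \<in> R \<or> (f (Suc i), f i) \<in> R)}"
  shows "underlying_iso f \<lparr>pverts = {0..<Suc m}, parcs = steps S\<rparr> \<lparr>pverts = pverts D, parcs = R\<rparr>"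
proof -
  have *: "(u, v) \<in> map_prod f f ` (steps S \<union> (steps S)\<inverse>) \<and>
      (v, u) \<in> map_prod f f ` (steps S \<union> (steps S)\<inverse>)" if uv: "(u, v) \<in> R" for u v
  proof -
    from uv R have "(u, v) \<in> parcs D" by auto
    from underlying_iso_arc_preimage[OF iso this, unfolded dpath_Suc_sel] obtain x y where
      xy: "u = f x" "v = f y" "(x, y) \<in> steps {..<m} \<or> (y, x) \<in> steps {..<m}" .
    from xy(3) have "(x, y) \<in> steps S \<or> (y, x) \<in> steps S"
      using uv unfolding xy(1,2) S by auto
    then have "(x, y) \<in> steps S \<union> (steps S)\<inverse>" "(y, x) \<in> steps S \<union> (steps S)\<inverse>" by auto
    then show ?thesis unfolding xy(1,2) by (intro conjI map_prod_imageI)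
  qed
  have "R \<union> R\<inverse> = map_prod f f ` (steps S \<union> (steps S)\<inverse>)"
  proof (intro equalityI subsetI)
    fix e assume "e \<in> R \<union> R\<inverse>"
    moreover obtain u v where e: "e = (u, v)" by (cases e)
    ultimately have "(u, v) \<in> R \<or> (v, u) \<in> R" by simp
    then show "e \<in> map_prod f f ` (steps S \<union> (steps S)\<inverse>)"
      unfolding e using *[of u v] *[of v u] by metis
  next
    fix e assume "e \<in> map_prod f f ` (steps S \<union> (steps S)\<inverse>)"
    then show "e \<in> R \<union> R\<inverse>" unfolding S by auto
  qed
  then show ?thesis using iso by (simp add: underlying_iso_conv)
qed

text \<open>The orientation of a path affects a density only by a sign, so absolute values can be
  computed on the directed path. This is enough for vanishing and for bounds.\<close>

lemma (in skew_kernel) path_subgraph_dens: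
  assumes iso: "underlying_iso f (dpath (Suc m)) D" and asym: "asym (parcs D)" and R: "R \<subseteq> parcs D"
  obtains S where "S \<subseteq> {..<m}" "card S = card R"
    "\<bar>dens n B (pverts D) R\<bar> = \<bar>closed_runs moment S m * moment (run S m)\<bar>"
    "underlying_iso f (arc_graph (steps S)) (arc_graph R)"
proof -
  define S where "S = {i. i < m \<and> ((f i, f (Suc i)) \<in> R \<or> (f (Suc i), f i) \<in> R)}"
  let ?G = "\<lparr>pverts = {0..<Suc m}, parcs = steps S\<rparr>" and ?H = "\<lparr>pverts = pverts D, parcs = R\<rparr>"
  have iso': "underlying_iso f ?G ?H"
    by (rule underlying_iso_path_subgraph[OF iso R S_def])
  have S: "S \<subseteq> {..<m}" by (auto simp: S_def)
  then have wf: "parcs ?G \<subseteq> pverts ?G \<times> pverts ?G" by auto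
  have as: "asym (parcs ?G)" "asym (parcs ?H)"
    using asym_steps[of S] asym_subset[OF asym R] by simp_all
  have "card (steps S) = card R"
    using bij_betw_same_card[OF underlying_iso_arcs_bij_betw[OF iso' wf as]] by simp
  moreover have "card (steps S) = card S" by (rule card_image) (auto simp: inj_on_def)
  ultimately have "card S = card R" by simp
  moreover have "\<bar>dens n B (pverts D) R\<bar> = \<bar>dens n B {0..<Suc m} (steps S)\<bar>"
    using dens_underlying_iso[OF iso' wf _ as] by (simp add: abs_mult power_abs)
  then have "\<bar>dens n B (pverts D) R\<bar> = \<bar>closed_runs moment S m * moment (run S m)\<bar>"
    using dens_path[OF S] by simp
  moreover have "underlying_iso f (arc_graph (steps S)) (arc_graph R)"
    using underlying_iso_arc_graph[OF iso' wf] by simp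
  ultimately show ?thesis using that S by blast
qed

lemma oriented_pathE:
  assumes "oriented_path D"
  obtains m f where "underlying_iso f (dpath (Suc m)) D"
proof -
  obtain m f where "m \<ge> 1" "underlying_iso f (dpath m) D"
    using assms by (auto simp: oriented_path_def)
  then show ?thesis using that[of f "m - 1"] by simp
qed

section \<open>Arc sets of size two and four\<close>

lemma dominoes_card:
  assumes "card (T \<union> Suc ` T) = 2 * j" "T \<inter> Suc ` T = {}" "j > 0"
  shows "finite T" "card T = j"
proof -
  \<comment> \<open>An infinite set would have \<open>card\<close> 0, which \<open>j > 0\<close>
    excludes.\<close>
  have fin: "finite (T \<union> Suc ` T)" by (rule card_ge_0_finite) (use assms in simp)
  then show "finite T" by simp
  have "card (T \<union> Suc ` T) = card T + card (Suc ` T)"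
    using fin assms(2) by (intro card_Un_disjoint) auto
  then show "card T = j" using assms(1) by (simp add: card_image)
qed

context skew_kernel
begin

text \<open>A nonzero density forces a domino tiling, and two arcs leave room for one domino
  only.\<close>

lemma dens_nonzero_card_2:
  assumes D: "oriented_path D" and R: "R \<subseteq> parcs D" "card R = 2" "dens n B (pverts D) R \<noteq> 0"
  shows "R \<in> copy_arcs (dpath 3) D"
proof -
  obtain m f where iso: "underlying_iso f (dpath (Suc m)) D" using D by (rule oriented_pathE)
  have as: "asym (parcs D)" using D by (simp add: oriented_path_def)
  obtain S where S: "S \<subseteq> {..<m}" "card S = card R"
    "\<bar>dens n B (pverts D) R\<bar> = \<bar>closed_runs moment S m * moment (run S m)\<bar>"
    "underlying_iso f (arc_graph (steps S)) (arc_graph R)"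
    using path_subgraph_dens[OF iso as R(1)] .
  have "closed_runs moment S m * moment (run S m) \<noteq> 0" using S(3) R(3) by (metis abs_zero abs_eq_0_iff)
  from runs_dominoes[of moment, OF moment_odd S(1) this]
  obtain T where T: "S = T \<union> Suc ` T" "T \<inter> Suc ` T = {}" by blast
  have "card (T \<union> Suc ` T) = 2 * 1" unfolding T(1)[symmetric] S(2) R(2) by simp
  from dominoes_card(2)[OF this T(2)] have "card T = 1" by simp
  then obtain i where Ti: "T = {i}" by (rule card_1_singletonE)
  have Si: "S = {i, Suc i}" unfolding T(1) Ti by auto
  have "underlying_iso (f \<circ> (+) i) (dpath 3) (arc_graph R)"
    by (rule underlying_iso_comp[OF underlying_iso_dpath3_steps S(4)[unfolded Si]])
  then show ?thesis using R by (auto simp: copy_arcs_def)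
qed

text \<open>Two dominoes either abut, giving four consecutive arcs, or leave a gap, giving two
  vertex-disjoint copies of \<open>dpath 3\<close>.\<close>

lemma dens_nonzero_card_4:
  assumes D: "oriented_path D" and R: "R \<subseteq> parcs D" "card R = 4" "dens n B (pverts D) R \<noteq> 0"
  shows "R \<in> copy_arcs (dpath 5) D \<union> copy_arcs two_P3 D"
proof -
  obtain m f where iso: "underlying_iso f (dpath (Suc m)) D" using D by (rule oriented_pathE)
  have as: "asym (parcs D)" using D by (simp add: oriented_path_def)
  obtain S where S: "S \<subseteq> {..<m}" "card S = card R"
    "\<bar>dens n B (pverts D) R\<bar> = \<bar>closed_runs moment S m * moment (run S m)\<bar>"
    "underlying_iso f (arc_graph (steps S)) (arc_graph R)"
    using path_subgraph_dens[OF iso as R(1)] .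
  have "closed_runs moment S m * moment (run S m) \<noteq> 0" using S(3) R(3) by (metis abs_zero abs_eq_0_iff)
  from runs_dominoes[of moment, OF moment_odd S(1) this]
  obtain T where T: "S = T \<union> Suc ` T" "T \<inter> Suc ` T = {}" by blast
  have "card (T \<union> Suc ` T) = 2 * 2" unfolding T(1)[symmetric] S(2) R(2) by simp
  from dominoes_card(2)[OF this T(2)] have "card T = 2" by simp
  then obtain i k where Tik: "T = {i, k}" and "i < k"
    by (metis card_2_iff doubleton_eq_iff linorder_neqE_nat)
  have Sik: "S = {i, Suc i, k, Suc k}" unfolding T(1) Tik by auto
  \<comment> \<open>Left ends at distance one would make the dominoes overlap.\<close>
  have "k \<noteq> Suc i" using T(2) unfolding Tik by auto
  with \<open>i < k\<close> consider "k = Suc (Suc i)" | "i + 3 \<le> k" by linarith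
  then show ?thesis
  proof cases
    case 1
    then have consec: "S = {i, Suc i, Suc (Suc i), Suc (Suc (Suc i))}" using Sik by simp
    have "underlying_iso (f \<circ> (+) i) (dpath 5) (arc_graph R)"
      by (rule underlying_iso_comp[OF underlying_iso_dpath5_steps S(4)[unfolded consec]])
    then show ?thesis using R by (auto simp: copy_arcs_def)
  next
    case 2
    have "underlying_iso (f \<circ> case_sum ((+) i) ((+) k)) two_P3 (arc_graph R)"
      by (rule underlying_iso_comp[OF underlying_iso_two_P3_steps[OF 2] S(4)[unfolded Sik]])
    then show ?thesis using R by (auto simp: copy_arcs_def)
  qed
qed

end

lemma copy_arcs_card:
  assumes "R \<in> copy_arcs G D" "asym (parcs D)" "parcs G \<subseteq> pverts G \<times> pverts G" "asym (parcs G)"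
  shows "card R = card (parcs G)"
proof -
  obtain f where f: "underlying_iso f G (arc_graph R)" and R: "R \<subseteq> parcs D"
    using assms(1) by (auto simp: copy_arcs_def)
  have "asym (parcs (arc_graph R))" using asym_subset[OF assms(2) R] by simp
  from bij_betw_same_card[OF underlying_iso_arcs_bij_betw[OF f assms(3,4) this]] show ?thesis by simp
qed

lemma copy_arcs_dpath5_two_P3_disjoint: "copy_arcs (dpath 5) D \<inter> copy_arcs two_P3 D = {}"
proof -
  have False if "underlying_iso f (dpath 5) H" "underlying_iso g two_P3 H" for f g and H :: "'a pair_pre_digraph"
  proof -
    have "card (pverts H) = card (pverts (dpath 5))" "card (pverts H) = card (pverts two_P3)"
      using that bij_betw_same_card unfolding underlying_iso_conv by metis+
    moreover have "card (pverts (dpath 5)) = 5" by (simp add: dpath_def)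
    moreover have "card (pverts two_P3) = 6" by (simp add: two_P3_sel)
    ultimately show False by (simp only:)
  qed
  then show ?thesis by (auto simp: copy_arcs_def)
qed

lemma dpath_numeral:
  "dpath 3 = dpath (Suc 2)" "dpath 5 = dpath (Suc 4)"
  by simp_all

context skew_kernel
begin

text \<open>Arc sets that are not copies of \<open>dpath 3\<close> have density 0, so the sum over
  all sets of this size reduces to a sum over copies.\<close>

lemma sum_dens_card_2:
  assumes D: "oriented_path D"
  shows "(\<Sum>R | R \<subseteq> parcs D \<and> card R = 2. dens n B (pverts D) R) = signed_count (dpath 3) D * moment 2"
proof -
  have fin: "pair_fin_digraph D" and as: "asym (parcs D)"
    using D by (simp_all add: oriented_path_def pair_digraph_def)
  have wf: "parcs (dpath 3) \<subseteq> pverts (dpath 3) \<times> pverts (dpath 3)" "finite (pverts (dpath 3))"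
      "asym (parcs (dpath 3))" "card (parcs (dpath 3)) = 2"
    using dpath_Suc_wf[of 2] by (simp_all only: dpath_numeral)
  have "(\<Sum>R | R \<subseteq> parcs D \<and> card R = 2. dens n B (pverts D) R)
      = (\<Sum>R\<in>copy_arcs (dpath 3) D. dens n B (pverts D) R)"
  proof (rule sum.mono_neutral_right)
    show "finite {R. R \<subseteq> parcs D \<and> card R = 2}"
      using pair_fin_digraph.pair_finite_arcs[OF fin] by simp
    show "copy_arcs (dpath 3) D \<subseteq> {R. R \<subseteq> parcs D \<and> card R = 2}"
      using copy_arcs_card[OF _ as wf(1,3)] wf(4) by (auto simp: copy_arcs_def)
  qed (use dens_nonzero_card_2[OF D] in auto)
  also have "\<dots> = signed_count (dpath 3) D * moment 2"
    using sum_dens_copy_arcs[OF fin as wf(1-3)] by (simp only: dpath_numeral dens_dpath)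
  finally show ?thesis .
qed

lemma sum_dens_card_4:
  assumes D: "oriented_path D"
  shows "(\<Sum>R | R \<subseteq> parcs D \<and> card R = 4. dens n B (pverts D) R) =
    signed_count (dpath 5) D * moment 4 + signed_count two_P3 D * (moment 2)\<^sup>2"
proof -
  have fin: "pair_fin_digraph D" and as: "asym (parcs D)"
    using D by (simp_all add: oriented_path_def pair_digraph_def)
  have wf: "parcs (dpath 5) \<subseteq> pverts (dpath 5) \<times> pverts (dpath 5)" "finite (pverts (dpath 5))"
      "asym (parcs (dpath 5))" "card (parcs (dpath 5)) = 4"
    using dpath_Suc_wf[of 4] by (simp_all only: dpath_numeral)
  have wf': "parcs two_P3 \<subseteq> pverts two_P3 \<times> pverts two_P3" "finite (pverts two_P3)"
      "card (parcs two_P3) = 4"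
    by (auto simp: two_P3_sel)
  have finR: "finite {R. R \<subseteq> parcs D \<and> card R = 4}"
    using pair_fin_digraph.pair_finite_arcs[OF fin] by simp
  have sub: "copy_arcs (dpath 5) D \<union> copy_arcs two_P3 D \<subseteq> {R. R \<subseteq> parcs D \<and> card R = 4}"
    using copy_arcs_card[OF _ as wf(1,3)] copy_arcs_card[OF _ as wf'(1) asym_two_P3] wf(4) wf'(3)
    by (auto simp: copy_arcs_def)
  have "(\<Sum>R | R \<subseteq> parcs D \<and> card R = 4. dens n B (pverts D) R)
      = (\<Sum>R\<in>copy_arcs (dpath 5) D \<union> copy_arcs two_P3 D. dens n B (pverts D) R)"
    by (rule sum.mono_neutral_right[OF finR sub]) (use dens_nonzero_card_4[OF D] in auto)
  also have "\<dots> = (\<Sum>R\<in>copy_arcs (dpath 5) D. dens n B (pverts D) R)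
      + (\<Sum>R\<in>copy_arcs two_P3 D. dens n B (pverts D) R)"
    using finite_subset[OF sub finR] copy_arcs_dpath5_two_P3_disjoint by (intro sum.union_disjoint) auto
  also have "(\<Sum>R\<in>copy_arcs (dpath 5) D. dens n B (pverts D) R) = signed_count (dpath 5) D * moment 4"
    using sum_dens_copy_arcs[OF fin as wf(1-3)] by (simp only: dpath_numeral dens_dpath)
  also have "(\<Sum>R\<in>copy_arcs two_P3 D. dens n B (pverts D) R) = signed_count two_P3 D * (moment 2)\<^sup>2"
    using sum_dens_copy_arcs[OF fin as wf'(1,2) asym_two_P3] by (simp only: dens_two_P3)
  finally show ?thesis .
qed

section \<open>Uniform bounds on the density of an arc set\<close>

text \<open>
  Submultiplicative when \<open>q\<close> bounds all ratios \<open>energy (k + 1) / energy k\<close>, which is what makes it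
  a bound for the product over the runs.
\<close>

definition size_bound :: "real \<Rightarrow> nat \<Rightarrow> real" where
  "size_bound q j = (if j = 0 then 1 else if j = 2 then energy 1 else if j = 4 then energy 2
     else if j \<ge> 5 then q * energy 2 else 0)"

text \<open>The bound is read off the runs: \<open>runs_bound\<close> is applied with
  \<open>size_bound q\<close> as a submultiplicative majorant of the moments.\<close>

lemma abs_dens_le_size_bound:
  assumes D: "oriented_path D" and R: "R \<subseteq> parcs D"
    and q: "0 \<le> q" "q \<le> 1" and step: "\<And>k. energy (Suc k) \<le> q * energy k"
  shows "\<bar>dens n B (pverts D) R\<bar> \<le> size_bound q (card R)"
proof -
  have e1: "energy 1 \<le> q" using step[of 0] by (simp add: energy_0)
  have e2: "energy 2 \<le> q * energy 1" using step[of 1] by (simp add: numeral_2_eq_2)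
  also have "\<dots> \<le> q" using mult_left_mono[of "energy 1" 1 q] e1 q by simp
  finally have e2': "energy 2 \<le> q" .
  have e12: "energy 1 * energy 1 \<le> energy 2"
    using energy_logconvex[of 0] by (simp add: energy_0 power2_eq_square numeral_2_eq_2)
  have qe2: "q * energy 2 \<le> energy 2" "q * energy 2 \<le> q"
    using mult_right_mono[of q 1 "energy 2"] mult_left_mono[of "energy 2" 1 q] q e2' energy_nonneg[of 2] by simp_all
  \<comment> \<open>Beyond index 2 the first step gains the factor \<open>q\<close>; further steps
    use only \<open>q \<le> 1\<close>.\<close>
  have big: "energy (k + 3) \<le> q * energy 2" for k
  proof (induction k)
    case 0
    then show ?case using step[of 2] by (simp add: numeral_eq_Suc)
  next
    case (Suc k)
    have "energy (Suc k + 3) \<le> q * energy (k + 3)" using step[of "k + 3"] by simp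
    also have "\<dots> \<le> energy (k + 3)" using q energy_nonneg mult_right_mono[of q 1] by simp
    finally show ?case using Suc by simp
  qed
  have nonneg: "size_bound q j \<ge> 0" for j
    using q energy_nonneg by (simp add: size_bound_def)
  have mom: "\<bar>moment j\<bar> \<le> size_bound q j" for j
  proof (cases "even j")
    case True
    then obtain k where k: "j = 2 * k" by auto
    have "\<bar>moment j\<bar> = energy k" using moment_even[of k] k energy_nonneg[of k] by (simp add: abs_mult power_abs)
    moreover have "energy k \<le> size_bound q (2 * k)"
    proof -
      consider "k = 0" | "k = 1" | "k = 2" | "k \<ge> 3" by linarith
      then show ?thesis
      proof cases
        case 4
        then show ?thesis using big[of "k - 3"] by (simp add: size_bound_def)
      qed (simp_all add: size_bound_def energy_0)
    qed
    ultimately show ?thesis using k by simp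
  qed (use nonneg moment_odd in auto)
  have small: "size_bound q j \<le> q" if "j \<ge> 1" for j
    using that q e1 e2' qe2 by (simp add: size_bound_def)
  have large: "size_bound q j \<le> energy 2" if "j \<ge> 4" for j
    using that q qe2 by (simp add: size_bound_def)
  \<comment> \<open>Unless an index is 0, a factor vanishes or both indices are 2, one index is at
    least 4 and supplies \<open>energy 2\<close> while the other supplies \<open>q\<close>. For 2
    and 2, log-convexity at 0 is what helps.\<close>
  have mult: "size_bound q j * size_bound q k \<le> size_bound q (j + k)" for j k
  proof -
    consider "j = 0 \<or> k = 0" | "j \<ge> 1" "k \<ge> 4" | "j \<ge> 4" "k \<ge> 1" | "j = 2" "k = 2"
      | "j \<in> {1, 3} \<or> k \<in> {1, 3}" by fastforce
    then show ?thesis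
    proof cases
      case 1
      then show ?thesis by (auto simp: size_bound_def)
    next
      case 2
      then have "size_bound q j * size_bound q k \<le> q * energy 2"
        using small large nonneg q by (intro mult_mono) auto
      then show ?thesis using 2 by (simp add: size_bound_def)
    next
      case 3
      then have "size_bound q j * size_bound q k \<le> energy 2 * q"
        using small large nonneg energy_nonneg by (intro mult_mono) auto
      then show ?thesis using 3 by (simp add: size_bound_def mult.commute)
    next
      case 4
      then show ?thesis using e12 by (simp add: size_bound_def)
    next
      case 5
      then have "size_bound q j = 0 \<or> size_bound q k = 0" by (auto simp: size_bound_def)
      then show ?thesis using nonneg by auto
    qed
  qed
  obtain m f where iso: "underlying_iso f (dpath (Suc m)) D" using D by (rule oriented_pathE)
  have as: "asym (parcs D)" using D by (simp add: oriented_path_def)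
  obtain S where S: "S \<subseteq> {..<m}" "card S = card R"
    "\<bar>dens n B (pverts D) R\<bar> = \<bar>closed_runs moment S m * moment (run S m)\<bar>"
    using path_subgraph_dens[OF iso as R] by metis
  have "size_bound q 0 \<ge> 1" by (simp add: size_bound_def)
  from runs_bound[where b = "size_bound q" and w = moment, OF nonneg mom this mult S(1)] S(2,3)
  show ?thesis by simp
qed

end

section \<open>The expansion of the homomorphism density\<close>

text \<open>Expanding the product of \<open>B + 1/2\<close> leaves a factor \<open>1/2\<close> for
  each arc outside \<open>R\<close>; the prefactor \<open>2 ^ card (parcs D)\<close> turns these
  into \<open>2 ^ card R\<close>.\<close>

lemma hom_density_expansion:
  assumes A: "weighted_tournament n A" and fin: "finite (parcs D)"
    and wf: "parcs D \<subseteq> pverts D \<times> pverts D"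
  shows "2 ^ card (parcs D) * hom_density D A =
    (\<Sum>R\<in>Pow (parcs D). 2 ^ card R * dens n (\<lambda>x y. skew_part A $$ (x, y)) (pverts D) R)"
proof -
  let ?B = "\<lambda>x y. skew_part A $$ (x, y)" and ?\<Phi> = "pverts D \<rightarrow>\<^sub>E {0..<n}"
  have dim: "dim_row A = n" "dim_col A = n" using A by (auto simp: weighted_tournament_def)
  have AB: "A $$ (x, y) = ?B x y + 1 / 2" if "x < n" "y < n" for x y
    using that dim by (simp add: skew_part_def)
  have "(\<Sum>\<phi>\<in>?\<Phi>. \<Prod>(x, y)\<in>parcs D. A $$ (\<phi> x, \<phi> y))
      = (\<Sum>\<phi>\<in>?\<Phi>. \<Sum>R\<in>Pow (parcs D). (\<Prod>(x, y)\<in>R. ?B (\<phi> x) (\<phi> y)) * (1 / 2) ^ card (parcs D - R))"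
  proof (rule sum.cong[OF refl])
    fix \<phi> assume \<phi>: "\<phi> \<in> ?\<Phi>"
    have "(\<Prod>(x, y)\<in>parcs D. A $$ (\<phi> x, \<phi> y))
        = (\<Prod>e\<in>parcs D. (case e of (x, y) \<Rightarrow> ?B (\<phi> x) (\<phi> y)) + 1 / 2)"
    proof (rule prod.cong[OF refl])
      fix e assume "e \<in> parcs D"
      moreover obtain x y where e: "e = (x, y)" by (cases e)
      ultimately have "x \<in> pverts D" "y \<in> pverts D" using wf by auto
      then have "\<phi> x < n" "\<phi> y < n" using \<phi> by (auto simp: PiE_def Pi_def)
      then show "(case e of (x, y) \<Rightarrow> A $$ (\<phi> x, \<phi> y)) = (case e of (x, y) \<Rightarrow> ?B (\<phi> x) (\<phi> y)) + 1 / 2"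
        unfolding e by (simp add: AB)
    qed
    then show "(\<Prod>(x, y)\<in>parcs D. A $$ (\<phi> x, \<phi> y))
        = (\<Sum>R\<in>Pow (parcs D). (\<Prod>(x, y)\<in>R. ?B (\<phi> x) (\<phi> y)) * (1 / 2) ^ card (parcs D - R))"
      by (simp add: prod_add[OF fin])
  qed
  also have "\<dots> = (\<Sum>R\<in>Pow (parcs D). (\<Sum>\<phi>\<in>?\<Phi>. \<Prod>(x, y)\<in>R. ?B (\<phi> x) (\<phi> y)) * (1 / 2) ^ card (parcs D - R))"
    by (subst sum.swap) (simp add: sum_distrib_right)
  finally have "hom_density D A = (\<Sum>R\<in>Pow (parcs D). dens n ?B (pverts D) R * (1 / 2) ^ card (parcs D - R))"
    unfolding hom_density_def dim dens_def by (simp only: sum_divide_distrib[where A = "Pow (parcs D)"] times_divide_eq_left)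
  then have "2 ^ card (parcs D) * hom_density D A =
      (\<Sum>R\<in>Pow (parcs D). 2 ^ card (parcs D) * (dens n ?B (pverts D) R * (1 / 2) ^ card (parcs D - R)))"
    by (simp only: sum_distrib_left)
  also have "\<dots> = (\<Sum>R\<in>Pow (parcs D). 2 ^ card R * dens n ?B (pverts D) R)"
  proof (rule sum.cong[OF refl])
    fix R assume R: "R \<in> Pow (parcs D)"
    then have "card (parcs D) = card R + card (parcs D - R)"
      using fin by (simp add: card_Diff_subset card_mono finite_subset)
    then have pow: "2 ^ card (parcs D) * (1 / 2 :: real) ^ card (parcs D - R) = 2 ^ card R"
      by (simp add: power_add power_one_over)
    have "2 ^ card (parcs D) * (dens n ?B (pverts D) R * (1 / 2) ^ card (parcs D - R))
        = 2 ^ card (parcs D) * (1 / 2) ^ card (parcs D - R) * dens n ?B (pverts D) R"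
      by (simp only: mult_ac)
    then show "2 ^ card (parcs D) * (dens n ?B (pverts D) R * (1 / 2) ^ card (parcs D - R))
        = 2 ^ card R * dens n ?B (pverts D) R"
      by (simp only: pow)
  qed
  finally show ?thesis .
qed

lemma weighted_tournament_skew_kernel:
  assumes "weighted_tournament n A" "n \<ge> 1"
  shows "skew_kernel n (\<lambda>x y. skew_part A $$ (x, y))"
proof
  fix x y assume "x < n" "y < n"
  then have "A $$ (x, y) + A $$ (y, x) = 1" "dim_row A = n" "dim_col A = n"
    using assms by (auto simp: weighted_tournament_def)
  then show "skew_part A $$ (y, x) = - skew_part A $$ (x, y)"
    using \<open>x < n\<close> \<open>y < n\<close> by (simp add: skew_part_def)
qed (use assms in simp)

abbreviation tournament_energy :: "nat \<Rightarrow> real mat \<Rightarrow> nat \<Rightarrow> real" where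
  "tournament_energy n A \<equiv> skew_kernel.energy n (\<lambda>x y. skew_part A $$ (x, y))"

text \<open>Sizes 0 and 4 are evaluated exactly, size 2 vanishes by \<open>c3\<close>, and all
  remaining sizes together contribute at most a single \<open>energy 2\<close>.\<close>

lemma hom_density_estimate:
  assumes D: "oriented_path D" and c3: "signed_count (dpath 3) D = 0"
    and A: "weighted_tournament n A" and n: "n \<ge> 1"
    and lam: "lambda_max (skew_part A) < (1/2) ^ card (parcs D) * n"
  shows "\<bar>2 ^ card (parcs D) * hom_density D A - 1 -
      16 * (signed_count (dpath 5) D * tournament_energy n A 2
        + signed_count two_P3 D * (tournament_energy n A 1)\<^sup>2)\<bar> \<le> tournament_energy n A 2"
proof -
  let ?E = "parcs D"
  \<comment> \<open>At most \<open>2 ^ card (parcs D)\<close> remaining arc sets, each weighted by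
    at most \<open>2 ^ card (parcs D)\<close>, carry the bound \<open>q * energy 2\<close>; this
    \<open>q\<close> makes the total bound exactly \<open>energy 2\<close>.\<close>
  define q :: real where "q = ((1/2) ^ card ?E)\<^sup>2"
  interpret skew_kernel n "\<lambda>x y. skew_part A $$ (x, y)"
    by (rule weighted_tournament_skew_kernel[OF A n])
  have carr: "skew_part A \<in> carrier_mat n n"
    using A by (auto simp: weighted_tournament_def skew_part_def)
  have step: "energy (Suc k) \<le> q * energy k" for k
    unfolding q_def by (rule energy_step_of_lambda_max[OF carr skew_kernel_axioms _ lam]) simp
  have q: "0 \<le> q" "q \<le> 1" by (simp_all add: q_def power_le_one)
  have fin: "pair_fin_digraph D" using D by (simp add: oriented_path_def pair_digraph_def)
  then interpret PD: pair_fin_digraph D .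
  have wf: "?E \<subseteq> pverts D \<times> pverts D"
    using PD.arc_fst_in_verts PD.arc_snd_in_verts by (simp add: subset_iff mem_Times_iff)
  have finE: "finite ?E" by (rule PD.pair_finite_arcs)
  define d where "d R = dens n (\<lambda>x y. skew_part A $$ (x, y)) (pverts D) R" for R
  define F where "F R = 2 ^ card R * d R" for R
  have total: "2 ^ card ?E * hom_density D A = (\<Sum>R\<in>Pow ?E. F R)"
    using hom_density_expansion[OF A finE wf] by (simp only: F_def d_def)
  define X where "X P = {R. R \<subseteq> ?E \<and> P (card R)}" for P :: "nat \<Rightarrow> bool"
  have finX: "finite (X P)" for P using finE by (simp add: X_def)
  have split: "sum F (X P) = sum F (X (\<lambda>j. j = c)) + sum F (X (\<lambda>j. P j \<and> j \<noteq> c))" if "P c" for P c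
  proof -
    have "X P = X (\<lambda>j. j = c) \<union> X (\<lambda>j. P j \<and> j \<noteq> c)" using that by (auto simp: X_def)
    moreover have "X (\<lambda>j. j = c) \<inter> X (\<lambda>j. P j \<and> j \<noteq> c) = {}" by (auto simp: X_def)
    ultimately show ?thesis using sum.union_disjoint[OF finX finX] by simp
  qed
  have "Pow ?E = X (\<lambda>j. True)" by (auto simp: X_def)
  then have "sum F (Pow ?E) = sum F (X (\<lambda>j. j = 0)) + sum F (X (\<lambda>j. j \<noteq> 0))"
    using split[of "\<lambda>j. True" 0] by simp
  also have "sum F (X (\<lambda>j. j \<noteq> 0)) = sum F (X (\<lambda>j. j = 2)) + sum F (X (\<lambda>j. j \<noteq> 0 \<and> j \<noteq> 2))"
    by (rule split) simp
  also have "sum F (X (\<lambda>j. j \<noteq> 0 \<and> j \<noteq> 2)) = sum F (X (\<lambda>j. j = 4)) + sum F (X (\<lambda>j. (j \<noteq> 0 \<and> j \<noteq> 2) \<and> j \<noteq> 4))"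
    by (rule split) simp
  also have "X (\<lambda>j. (j \<noteq> 0 \<and> j \<noteq> 2) \<and> j \<noteq> 4) = X (\<lambda>j. j \<notin> {0, 2, 4})"
    by (auto simp: X_def)
  finally have "sum F (Pow ?E) = sum F (X (\<lambda>j. j = 0)) + (sum F (X (\<lambda>j. j = 2))
      + (sum F (X (\<lambda>j. j = 4)) + sum F (X (\<lambda>j. j \<notin> {0, 2, 4}))))" .
  moreover have "sum F (X (\<lambda>j. j = 0)) = 1"
  proof -
    have "X (\<lambda>j. j = 0) = {{}}" by (auto simp: X_def card_eq_0_iff dest: finite_subset[OF _ finE])
    moreover have "d {} = 1"
      using n PD.pair_finite_verts by (simp add: d_def dens_def card_PiE)
    ultimately show ?thesis by (simp add: F_def)
  qed
  moreover have "sum F (X (\<lambda>j. j = 2)) = 0"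
  proof -
    have "sum F (X (\<lambda>j. j = 2)) = 4 * sum d (X (\<lambda>j. j = 2))"
      unfolding sum_distrib_left by (rule sum.cong) (auto simp: F_def X_def)
    also have "sum d (X (\<lambda>j. j = 2)) = 0"
      using sum_dens_card_2[OF D] c3 by (simp add: X_def d_def)
    finally show ?thesis by simp
  qed
  moreover have "sum F (X (\<lambda>j. j = 4)) =
      16 * (signed_count (dpath 5) D * energy 2 + signed_count two_P3 D * (energy 1)\<^sup>2)"
  proof -
    have "sum F (X (\<lambda>j. j = 4)) = 16 * sum d (X (\<lambda>j. j = 4))"
      unfolding sum_distrib_left by (rule sum.cong) (auto simp: F_def X_def)
    also have "sum d (X (\<lambda>j. j = 4)) =
        signed_count (dpath 5) D * moment 4 + signed_count two_P3 D * (moment 2)\<^sup>2"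
      using sum_dens_card_4[OF D] by (simp add: X_def d_def)
    \<comment> \<open>The signs are \<open>moment 4 = energy 2\<close> and
      \<open>moment 2 = - energy 1\<close>, the latter squared.\<close>
    finally show ?thesis using moment_even[of 1] moment_even[of 2] by simp
  qed
  moreover have "\<bar>sum F (X (\<lambda>j. j \<notin> {0, 2, 4}))\<bar> \<le> energy 2"
  proof -
    have bound: "\<bar>F R\<bar> \<le> 2 ^ card ?E * (q * energy 2)" if R: "R \<in> X (\<lambda>j. j \<notin> {0, 2, 4})" for R
    proof -
      have RE: "R \<subseteq> ?E" and cR: "card R \<notin> {0, 2, 4}" using R by (auto simp: X_def)
      have "\<bar>d R\<bar> \<le> size_bound q (card R)"
        unfolding d_def by (rule abs_dens_le_size_bound[OF D RE q step])
      \<comment> \<open>Sizes 1 and 3 fall under this case too, and there \<open>size_bound\<close>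
        is 0.\<close>
      also have "\<dots> \<le> q * energy 2"
        using cR q energy_nonneg by (simp add: size_bound_def)
      finally have "\<bar>d R\<bar> \<le> q * energy 2" .
      moreover have "card R \<le> card ?E" using finE RE by (rule card_mono)
      then have "(2::real) ^ card R \<le> 2 ^ card ?E" by (simp add: power_increasing)
      ultimately show ?thesis by (simp add: F_def abs_mult mult_mono)
    qed
    have "\<bar>sum F (X (\<lambda>j. j \<notin> {0, 2, 4}))\<bar> \<le> (\<Sum>R\<in>X (\<lambda>j. j \<notin> {0, 2, 4}). \<bar>F R\<bar>)"
      by (rule sum_abs)
    also have "\<dots> \<le> card (X (\<lambda>j. j \<notin> {0, 2, 4})) * (2 ^ card ?E * (q * energy 2))"
      by (rule sum_bounded_above) (rule bound)
    also have "\<dots> \<le> 2 ^ card ?E * (2 ^ card ?E * (q * energy 2))"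
    proof (rule mult_right_mono)
      have "card (X (\<lambda>j. j \<notin> {0, 2, 4})) \<le> card (Pow ?E)"
        using finE by (intro card_mono) (auto simp: X_def)
      then show "real (card (X (\<lambda>j. j \<notin> {0, 2, 4}))) \<le> 2 ^ card ?E"
        using finE by (simp add: card_Pow of_nat_le_iff[symmetric] del: of_nat_le_iff)
    qed (use q energy_nonneg in simp)
    also have "\<dots> = energy 2" by (simp add: q_def power2_eq_square power_one_over)
    finally show ?thesis .
  qed
  ultimately show ?thesis unfolding total by simp
qed

section \<open>Tournaments perturbed on a single pair\<close>

text \<open>Only the pair 0, 1 deviates from \<open>1/2\<close>; the other vertices are padding,
  whose number tunes the ratio of \<open>(energy 1)\<^sup>2\<close> to
  \<open>energy 2\<close>.\<close>

definition block_tournament :: "nat \<Rightarrow> real \<Rightarrow> real mat" where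
  "block_tournament n b = mat n n (\<lambda>(x, y). 1/2 + (if x = 0 \<and> y = 1 then b else if x = 1 \<and> y = 0 then - b else 0))"

lemma block_tournament_weighted:
  assumes "0 < b" "b \<le> 1/2"
  shows "weighted_tournament n (block_tournament n b)"
  using assms by (auto simp: weighted_tournament_def block_tournament_def)

lemma skew_part_block_tournament:
  "skew_part (block_tournament n b) = mat n n (\<lambda>(x, y). if x = 0 \<and> y = 1 then b else if x = 1 \<and> y = 0 then - b else 0)"
  by (rule eq_matI) (auto simp: skew_part_def block_tournament_def)

lemma sum_lessThan_first_two:
  fixes g :: "nat \<Rightarrow> 'a::comm_monoid_add"
  assumes "n \<ge> 2" "\<And>x. x \<ge> 2 \<Longrightarrow> x < n \<Longrightarrow> g x = 0"
  shows "(\<Sum>x<n. g x) = g 0 + g 1"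
proof -
  have "(\<Sum>x<n. g x) = (\<Sum>x\<in>{0, 1}. g x)"
    by (rule sum.mono_neutral_right) (use assms in \<open>auto simp: less_2_cases_iff not_less[symmetric]\<close>)
  then show ?thesis by simp
qed

text \<open>For a nonzero eigenvalue \<open>k\<close> the eigenvector is supported on the vertices 0
  and 1, where using the two row equations in turn gives
  \<open>k\<^sup>2 = - (of_real b)\<^sup>2\<close>.\<close>

lemma lambda_max_block_tournament:
  assumes n: "n \<ge> 2" and b: "b > 0"
  shows "lambda_max (skew_part (block_tournament n b)) \<le> b"
proof -
  define C where "C = map_mat complex_of_real (skew_part (block_tournament n b))"
  have C: "C \<in> carrier_mat n n" by (simp add: C_def skew_part_block_tournament)
  from spectral_radius_mem_max(1)[OF C] n obtain k where
    k: "k \<in> spectrum C" and sk: "spectral_radius C = norm k" by auto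
  from k obtain v where "eigenvector C v k" by (auto simp: spectrum_def eigenvalue_def)
  then have v: "v \<in> carrier_vec n" "v \<noteq> 0\<^sub>v n" "C *\<^sub>v v = k \<cdot>\<^sub>v v"
    using C by (auto simp: eigenvector_def)
  have row: "(\<Sum>y<n. C $$ (x, y) * v $ y) = k * v $ x" if "x < n" for x
  proof -
    have "(C *\<^sub>v v) $ x = (\<Sum>y<n. C $$ (x, y) * v $ y)"
      using C v(1) that by (simp add: scalar_prod_def lessThan_atLeast0)
    moreover have "(C *\<^sub>v v) $ x = k * v $ x" unfolding v(3) using v(1) that by simp
    ultimately show ?thesis by simp
  qed
  have ent: "C $$ (x, y) = (if x = 0 \<and> y = 1 then of_real b else if x = 1 \<and> y = 0 then - of_real b else 0)"
    if "x < n" "y < n" for x y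
    using that by (simp add: C_def skew_part_block_tournament)
  have r: "of_real b * v $ 1 = k * v $ 0" "- of_real b * v $ 0 = k * v $ 1"
    using row[of 0] row[of 1] n sum_lessThan_first_two[OF n, of "\<lambda>y. C $$ (0, y) * v $ y"]
      sum_lessThan_first_two[OF n, of "\<lambda>y. C $$ (1, y) * v $ y"] by (simp_all add: ent)
  have r0: "k * v $ x = 0" if "x \<ge> 2" "x < n" for x
    using row[of x] that by (simp add: ent)
  have "norm k \<le> b"
  proof (cases "k = 0")
    case False
    then have rest: "v $ x = 0" if "x \<ge> 2" "x < n" for x using r0 that by auto
    have "v $ 0 \<noteq> 0 \<or> v $ 1 \<noteq> 0"
    proof (rule ccontr)
      assume "\<not> ?thesis"
      then have "v $ x = 0" if "x < n" for x
        using rest[of x] that by (cases "x \<ge> 2") (auto simp: less_2_cases_iff not_le)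
      then show False using v by (auto intro!: eq_vecI)
    qed
    moreover have "(k\<^sup>2 + (of_real b)\<^sup>2) * v $ 0 = 0"
    proof -
      have "k * (k * v $ 0) = of_real b * (k * v $ 1)" unfolding r(1)[symmetric] by (simp only: mult_ac mult_minus_left mult_minus_right)
      also have "\<dots> = - (of_real b)\<^sup>2 * v $ 0" unfolding r(2)[symmetric] by (simp add: power2_eq_square)
      finally show ?thesis by (simp add: power2_eq_square algebra_simps)
    qed
    moreover have "(k\<^sup>2 + (of_real b)\<^sup>2) * v $ 1 = 0"
    proof -
      have "k * (k * v $ 1) = - of_real b * (k * v $ 0)" unfolding r(2)[symmetric] by (simp only: mult_ac mult_minus_left mult_minus_right)
      also have "\<dots> = - (of_real b)\<^sup>2 * v $ 1" unfolding r(1)[symmetric] by (simp add: power2_eq_square)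
      finally show ?thesis by (simp add: power2_eq_square algebra_simps)
    qed
    ultimately have "k\<^sup>2 = - (of_real b)\<^sup>2" by (auto simp: eq_neg_iff_add_eq_0)
    then have "(norm k)\<^sup>2 = b\<^sup>2"
      by (metis norm_minus_cancel norm_of_real norm_power power2_abs)
    then show ?thesis using b by (auto simp: power2_eq_iff)
  qed (use b in simp)
  then show ?thesis using sk by (simp add: lambda_max_def C_def)
qed

text \<open>After one step the walk lives on the vertices 0 and 1 with entries of modulus
  \<open>b / n\<close>, after two steps with entries of modulus \<open>(b / n)\<^sup>2\<close>;
  averaging the squares leaves the factor \<open>2 / n\<close>.\<close>

lemma energy_block_tournament:
  assumes n: "n \<ge> 2" and b: "0 < b" "b \<le> 1/2"
  shows "tournament_energy n (block_tournament n b) 1 = 2 * (b / n)\<^sup>2 / n" (is ?e1)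
    and "tournament_energy n (block_tournament n b) 2 = 2 * (b / n) ^ 4 / n" (is ?e2)
proof -
  interpret skew_kernel n "\<lambda>x y. skew_part (block_tournament n b) $$ (x, y)"
    by (rule weighted_tournament_skew_kernel[OF block_tournament_weighted[OF b]]) (use n in simp)
  have ent: "skew_part (block_tournament n b) $$ (x, y) =
      (if x = 0 \<and> y = 1 then b else if x = 1 \<and> y = 0 then - b else 0)" if "x < n" "y < n" for x y
    using that by (simp add: skew_part_block_tournament)
  have push: "push u x = (if x = 0 then - (b / n) * u 1 else if x = 1 then b / n * u 0 else 0)"
    if "x < n" for u x
    unfolding push_def by (subst sum_lessThan_first_two[OF n]) (use that n in \<open>auto simp: ent\<close>)
  have w1: "walk 1 x = (if x = 0 then - (b / n) else if x = 1 then b / n else 0)" if "x < n" for x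
    using push[OF that, of "walk 0"] walk_Suc[of 0] by (simp add: walk_0)
  have w2: "walk 2 x = (if x < 2 then - (b / n)\<^sup>2 else 0)" if "x < n" for x
    using push[OF that, of "walk 1"] walk_Suc[of 1] w1[of 0] w1[of 1] n
    by (auto simp: numeral_2_eq_2 power2_eq_square)
  show ?e1
    unfolding energy_def ip_def
    by (subst sum_lessThan_first_two[OF n]) (use n w1 in \<open>auto simp: power2_eq_square\<close>)
  show ?e2
    unfolding energy_def ip_def
    by (subst sum_lessThan_first_two[OF n]) (use n w2 in \<open>auto simp: power2_eq_square power4_eq_xxxx\<close>)
qed

section \<open>From the estimate to the local properties\<close>

text \<open>The form is affine in \<open>y\<close>, and at the ends \<open>y = 0\<close> and
  \<open>y = x\<close> it equals \<open>c * x\<close> and \<open>(c + d) * x\<close>. Both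
  coefficients are positive integers, hence at least 1.\<close>

lemma lower_combination:
  fixes c d :: int and x y :: real
  assumes "c > 0" "c > - d" and y: "0 \<le> y" "y \<le> x"
  shows "x \<le> of_int c * x + of_int d * y"
proof (cases "d \<ge> 0")
  case True
  have "1 * x \<le> of_int c * x" using assms by (intro mult_right_mono) auto
  moreover have "0 \<le> of_int d * y" using True y by simp
  ultimately show ?thesis by linarith
next
  case False
  have "1 * x \<le> of_int (c + d) * x" using assms by (intro mult_right_mono) linarith+
  moreover have "of_int d * x \<le> of_int d * y" using False y by (intro mult_left_mono_neg) auto
  ultimately show ?thesis by (simp add: algebra_simps)
qed

lemma tournament_energy_sq_le:
  assumes "weighted_tournament n A" "n \<ge> 1"
  shows "0 \<le> (tournament_energy n A 1)\<^sup>2" "(tournament_energy n A 1)\<^sup>2 \<le> tournament_energy n A 2"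
proof -
  interpret skew_kernel n "\<lambda>x y. skew_part A $$ (x, y)"
    by (rule weighted_tournament_skew_kernel[OF assms])
  show "(energy 1)\<^sup>2 \<le> energy 2"
    using energy_logconvex[of 0] by (simp add: energy_0 numeral_2_eq_2)
qed simp

lemma half_power_le_iff: "(1/2) ^ k \<le> (t::real) \<longleftrightarrow> 1 \<le> 2 ^ k * t" "t \<le> (1/2) ^ k \<longleftrightarrow> 2 ^ k * t \<le> 1"
  by (simp_all add: power_one_over field_simps)

text \<open>The local properties allow equality in the spectral condition while the estimate needs
  strictness; halving the threshold provides it.\<close>

lemma scaled_lambda_max_less:
  assumes "l \<le> (1/2) ^ Suc k * real n" "n \<ge> 1"
  shows "l < (1/2) ^ k * real n"
proof -
  have "(1/2) ^ Suc k * real n < (1/2) ^ k * real n" using assms by simp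
  then show ?thesis using assms by linarith
qed

lemma LTS_of_positive:
  assumes D: "oriented_path D" and c3: "signed_count (dpath 3) D = 0"
    and c: "signed_count (dpath 5) D > 0" "signed_count (dpath 5) D > - signed_count two_P3 D"
  shows "LTS D"
  unfolding LTS_def
proof (intro exI[of _ "(1/2) ^ Suc (card (parcs D))"] conjI allI impI)
  fix n A assume n: "1 \<le> (n::nat)"
    and A: "weighted_tournament n A \<and> lambda_max (skew_part A) \<le> (1/2) ^ Suc (card (parcs D)) * n"
  note en = tournament_energy_sq_le[OF conjunct1[OF A] n]
  \<comment> \<open>\<open>T\<close> stands for the scaled density, \<open>x\<close> for the second
    energy and \<open>Y\<close> for the quartic form: the main term \<open>16 * Y\<close> is at
    least \<open>16 * x\<close> and outweighs the error \<open>x\<close>.\<close>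
  have "1 \<le> T" if "\<bar>T - 1 - 16 * Y\<bar> \<le> x" "x \<le> Y" "0 \<le> y" "y \<le> x" for T Y x y :: real
    using that by linarith
  from this[OF hom_density_estimate[OF D c3 conjunct1[OF A] n scaled_lambda_max_less[OF conjunct2[OF A] n]]
    lower_combination[OF c en] en]
  have "1 \<le> 2 ^ card (parcs D) * hom_density D A" .
  then show "(1/2) ^ card (parcs D) \<le> hom_density D A" by (simp only: half_power_le_iff)
qed simp

lemma LTAS_of_negative:
  assumes D: "oriented_path D" and c3: "signed_count (dpath 3) D = 0"
    and c: "signed_count (dpath 5) D < 0" "signed_count (dpath 5) D < - signed_count two_P3 D"
  shows "LTAS D"
  unfolding LTAS_def
proof (intro exI[of _ "(1/2) ^ Suc (card (parcs D))"] conjI allI impI)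
  fix n A assume n: "1 \<le> (n::nat)"
    and A: "weighted_tournament n A \<and> lambda_max (skew_part A) \<le> (1/2) ^ Suc (card (parcs D)) * n"
  note en = tournament_energy_sq_le[OF conjunct1[OF A] n]
  have c': "- signed_count (dpath 5) D > 0" "- signed_count (dpath 5) D > - (- signed_count two_P3 D)"
    using c by simp_all
  from hom_density_estimate[OF D c3 conjunct1[OF A] n scaled_lambda_max_less[OF conjunct2[OF A] n]]
    lower_combination[OF c' en] en
  have "2 ^ card (parcs D) * hom_density D A \<le> 1" by simp
  then show "hom_density D A \<le> (1/2) ^ card (parcs D)" by (simp only: half_power_le_iff)
qed simp

text \<open>In this family the quartic form collapses to a single coefficient, depending on
  \<open>n\<close>, times the positive second energy \<open>x\<close>.\<close>

lemma block_tournament_density: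
  assumes D: "oriented_path D" and c3: "signed_count (dpath 3) D = 0" and n: "n \<ge> 2" and \<epsilon>: "\<epsilon> > 0"
  obtains A x where "weighted_tournament n A" "lambda_max (skew_part A) \<le> \<epsilon> * n" "x > 0"
    "\<bar>2 ^ card (parcs D) * hom_density D A - 1 -
      16 * ((signed_count (dpath 5) D + signed_count two_P3 D * (2 / n)) * x)\<bar> \<le> x"
proof -
  \<comment> \<open>The bound by \<open>\<epsilon>\<close> meets the spectral condition; the power
    of \<open>1/2\<close> meets that of the estimate and keeps the entries between 0 and 1.\<close>
  define b where "b = min \<epsilon> ((1/2) ^ Suc (card (parcs D)))"
  have "(1/2::real) ^ Suc (card (parcs D)) \<le> (1/2) ^ Suc 0" by (rule power_decreasing) auto
  then have b: "0 < b" "b \<le> 1/2" using \<epsilon> by (auto simp: b_def)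
  let ?A = "block_tournament n b"
  define x where "x = tournament_energy n ?A 2"
  have A: "weighted_tournament n ?A" by (rule block_tournament_weighted[OF b])
  have "b \<le> b * real n" using b n by simp
  moreover have "b * real n \<le> \<epsilon> * n" "b * real n \<le> (1/2) ^ Suc (card (parcs D)) * n"
    by (intro mult_right_mono; simp add: b_def)+
  ultimately have lam: "lambda_max (skew_part ?A) \<le> \<epsilon> * n"
    "lambda_max (skew_part ?A) \<le> (1/2) ^ Suc (card (parcs D)) * n"
    using lambda_max_block_tournament[OF n b(1)] by linarith+
  have n1: "n \<ge> 1" using n by simp
  have "(tournament_energy n ?A 1)\<^sup>2 = 2 / n * x"
    unfolding x_def energy_block_tournament[OF n b]
    by (simp add: power2_eq_square power4_eq_xxxx)
  with hom_density_estimate[OF D c3 A n1 scaled_lambda_max_less[OF lam(2) n1], folded x_def]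
  have "\<bar>2 ^ card (parcs D) * hom_density D ?A - 1 -
      16 * ((signed_count (dpath 5) D + signed_count two_P3 D * (2 / n)) * x)\<bar> \<le> x"
    by (simp only: distrib_right mult.assoc)
  moreover have "x > 0" unfolding x_def energy_block_tournament[OF n b] using b n by simp
  ultimately show ?thesis using that A lam(1) by blast
qed

text \<open>A coefficient of at most \<open>- 1/2\<close> makes the main term at most
  \<open>- 8 * x\<close>, which the error \<open>x\<close> cannot compensate.\<close>

lemma not_LTS_of_block:
  assumes "oriented_path D" "signed_count (dpath 3) D = 0" "n \<ge> 2"
    and neg: "signed_count (dpath 5) D + signed_count two_P3 D * (2 / real n) \<le> - 1/2"
  shows "\<not> LTS D"
proof
  assume "LTS D"
  then obtain \<epsilon> where \<epsilon>: "\<epsilon> > 0" and LTS: "\<And>n A. n \<ge> 1 \<Longrightarrow> weighted_tournament n A \<Longrightarrow>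
      lambda_max (skew_part A) \<le> \<epsilon> * real n \<Longrightarrow> (1/2) ^ card (parcs D) \<le> hom_density D A"
    unfolding LTS_def by blast
  obtain A x where A: "weighted_tournament n A" "lambda_max (skew_part A) \<le> \<epsilon> * n" and x: "x > 0"
    and est: "\<bar>2 ^ card (parcs D) * hom_density D A - 1 -
      16 * ((signed_count (dpath 5) D + signed_count two_P3 D * (2 / n)) * x)\<bar> \<le> x"
    using block_tournament_density[OF assms(1-3) \<epsilon>] .
  have T: "1 \<le> 2 ^ card (parcs D) * hom_density D A"
    using LTS[OF _ A] assms(3) by (simp only: half_power_le_iff)
  have Y: "(signed_count (dpath 5) D + signed_count two_P3 D * (2 / n)) * x \<le> (- 1/2) * x"
    using neg x by (intro mult_right_mono) auto
  have False if "1 \<le> T" "Y \<le> (- 1/2) * x" "\<bar>T - 1 - 16 * Y\<bar> \<le> x" for T Y :: real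
    using that x by linarith
  from this[OF T Y est] show False .
qed

lemma not_LTAS_of_block:
  assumes "oriented_path D" "signed_count (dpath 3) D = 0" "n \<ge> 2"
    and pos: "signed_count (dpath 5) D + signed_count two_P3 D * (2 / real n) \<ge> 1/2"
  shows "\<not> LTAS D"
proof
  assume "LTAS D"
  then obtain \<epsilon> where \<epsilon>: "\<epsilon> > 0" and LTAS: "\<And>n A. n \<ge> 1 \<Longrightarrow> weighted_tournament n A \<Longrightarrow>
      lambda_max (skew_part A) \<le> \<epsilon> * real n \<Longrightarrow> hom_density D A \<le> (1/2) ^ card (parcs D)"
    unfolding LTAS_def by blast
  obtain A x where A: "weighted_tournament n A" "lambda_max (skew_part A) \<le> \<epsilon> * n" and x: "x > 0"
    and est: "\<bar>2 ^ card (parcs D) * hom_density D A - 1 -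
      16 * ((signed_count (dpath 5) D + signed_count two_P3 D * (2 / n)) * x)\<bar> \<le> x"
    using block_tournament_density[OF assms(1-3) \<epsilon>] .
  have T: "2 ^ card (parcs D) * hom_density D A \<le> 1"
    using LTAS[OF _ A] assms(3) by (simp only: half_power_le_iff)
  have Y: "1/2 * x \<le> (signed_count (dpath 5) D + signed_count two_P3 D * (2 / n)) * x"
    using pos x by (intro mult_right_mono) auto
  have False if "T \<le> 1" "1/2 * x \<le> Y" "\<bar>T - 1 - 16 * Y\<bar> \<le> x" for T Y :: real
    using that x by linarith
  from this[OF T Y est] show False .
qed

lemma large_block_coefficient:
  fixes c d :: int
  assumes "c > 0"
  shows "\<exists>n\<ge>2. c + d * (2 / real n) \<ge> 1/2"
proof (intro exI conjI)
  \<comment> \<open>The multiple of \<open>\<bar>d\<bar>\<close> brings the second term down to at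
    most \<open>1/2\<close> in modulus, while \<open>c \<ge> 1\<close>; adding 2 ensures
    \<open>?n \<ge> 2\<close>.\<close>
  let ?n = "4 * nat \<bar>d\<bar> + 2"
  have "\<bar>d * (2 / real ?n)\<bar> \<le> 1/2" by (simp add: abs_mult field_simps)
  moreover have "real_of_int c \<ge> 1" using assms by simp
  ultimately show "c + d * (2 / real ?n) \<ge> 1/2" by linarith
qed simp

theorem theorem3p11:
  fixes D :: "'v pair_pre_digraph"
  assumes "oriented_path D"
    and "signed_count (dpath 3) D = 0"
    and "signed_count (dpath 5) D \<notin> {0, - signed_count two_P3 D}"
  shows "(signed_count (dpath 5) D > 0 \<and> signed_count (dpath 5) D > - signed_count two_P3 D
            \<longrightarrow> LTS D) \<and>
         (signed_count (dpath 5) D < 0 \<and> signed_count (dpath 5) D < - signed_count two_P3 D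
            \<longrightarrow> LTAS D) \<and>
         ((signed_count (dpath 5) D > 0 \<and> signed_count (dpath 5) D < - signed_count two_P3 D) \<or>
          (signed_count (dpath 5) D < 0 \<and> signed_count (dpath 5) D > - signed_count two_P3 D)
            \<longrightarrow> \<not> LTS D \<and> \<not> LTAS D)"
proof (intro conjI impI; (elim disjE conjE)?)
  let ?c = "signed_count (dpath 5) D" and ?d = "signed_count two_P3 D"
  note hyp = assms(1,2)
  show "LTS D" if "?c > 0" "?c > - ?d" using LTS_of_positive[OF hyp that] .
  show "LTAS D" if "?c < 0" "?c < - ?d" using LTAS_of_negative[OF hyp that] .
  \<comment> \<open>With two vertices the coefficient is \<open>?c + ?d\<close>, an integer of sign
    opposite to that of \<open>?c\<close>.\<close>
  show "\<not> LTS D" if "?c > 0" "?c < - ?d"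
    using not_LTS_of_block[OF hyp, of 2] that by simp
  show "\<not> LTAS D" if "?c < 0" "?c > - ?d"
    using not_LTAS_of_block[OF hyp, of 2] that by simp
  \<comment> \<open>With many vertices the coefficient approaches \<open>?c\<close> and takes its
    sign.\<close>
  show "\<not> LTAS D" if "?c > 0" "?c < - ?d"
    using large_block_coefficient[OF that(1), of ?d] not_LTAS_of_block[OF hyp] by blast
  show "\<not> LTS D" if "?c < 0" "?c > - ?d"
  proof -
    have "- ?c > 0" using that by simp
    from large_block_coefficient[OF this, of "- ?d"] obtain n where
      n: "n \<ge> 2" "of_int (- ?c) + of_int (- ?d) * (2 / real n) \<ge> 1/2" by (elim exE conjE)
    have "of_int ?c + of_int ?d * (2 / real n) \<le> - 1/2" using n(2) by simp
    then show ?thesis by (rule not_LTS_of_block[OF hyp n(1)])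
  qed
qed

end
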